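(* Suppose that $m,n\to\infty$ with $0<n\le m$ and $n/m\to\alpha\in[0,1]$. Then, for every $k=0,1,\dots$, (i) $$\mathbb P\bigl(d^{\mathsf U}(\mathcal T_{m,n})=k\bigr)=\frac1m\,\mathbb E\bigl(n_k^{\mathsf U}(\mathcal T_{m,n})\bigr)\to p^{\mathsf U}_\alpha(k):=\begin{cases}1-\alpha,&k=0,\\ \int_0^\alpha(1-\alpha+t)(1-e^{-t})^{k-1}\,dt,&k\ge1;\end{cases}$$ (ii) $$\mathbb P\bigl(d^{\mathsf L}(\mathcal T_{m,n})=k\bigr)=\frac1n\,\mathbb E\bigl(n_k^{\mathsf L}(\mathcal T_{m,n})\bigr)\to p^{\mathsf L}_\alpha(k):=\begin{cases}1-\alpha/2,&k=0,\\ \frac1\alpha\int_0^\alpha\bigl(\alpha-t-(\alpha-t)^2/2\bigr)(1-e^{-t})^{k-1}\,dt,&k\ge1;\end{cases}$$ (iii) $$\mathbb P\bigl(d^{\mathsf E}(\mathcal T_{m,n})=k\bigr)=\frac1n\,\mathbb E\bigl(n_k^{\mathsf E}(\mathcal T_{m,n})\bigr)\to p^{\mathsf E}_\alpha(k):=\begin{cases}1-\alpha/2,&k=0,\\ \frac1\alpha\int_0^\alpha(\alpha-t)e^{-t}(1-e^{-t})^{k-1}\,dt,&k\ge1.\end{cases}$$ (For $\alpha=0$, $p^{\mathsf L}_0(k)=p^{\mathsf E}_0(k)=0$ when $k\ge1$.) For every $\Xi\in\{\mathsf L,\mathsf E,\mathsf U\}$ and $\alpha\in[0,1]$, $\{p^\Xi_\alpha(k)\}_{k=0}^\infty$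 is a probability distribution on the nonnegative integers. If $D^\Xi_\alpha$ is a random variable with this distribution, i.e. $\mathbb P(D^\Xi_\alpha=k)=p^\Xi_\alpha(k)$, then these results can be written as convergence in distribution $$d^\Xi(\mathcal T_{m,n})\overset{\mathrm d}{\longrightarrow}D^\Xi_\alpha .$$ Moreover, all moments converge here, i.e. $\mathbb E\bigl[d^\Xi(\mathcal T_{m,n})^r\bigr]\to\mathbb E\bigl[(D^\Xi_\alpha)^r\bigr]$ for every $r\ge0$.
   Context: Hashing with coalesced chains. Let $0\le n\le m$ be integers. Items $x_1,\dots,x_n$ are placed sequentially into a table with $m$ cells $1,\dots,m$, using hash addresses $h_1,\dots,h_n\in\{1,\dots,m\}$. Each cell has a link field, initially null. If cell $h_i$ is empty, $x_i$ is inserted there (creating a new chain of length 1). If cell $h_i$ is occupied, $x_i$ is stored in the empty cell $j$ with largest index, and $j$ is linked into the chain containing $h_i$ according to one of two policies: - $\mathsf L$ (late-insertion): follow the links from $h_i$ to the end of the chain (a null link) and append a link there to cell $j$. - $\mathsf E$ (early-insertion): cell $j$ is linked into the chain immediately after $h_i$: if the link from $h_i$ points to $k$ (null or not), this link is reset to $j$, and the link of $j$ is set to $k$. Both policies give the same occupied cells and the same partition of them into chains; only the order within chains may differ. A hash table $\mathcal T$ is encoded by $m$, $n$ and $(h_1,\dots,h_n)$, and both policies are considered together. The random hash table $\mathcal T_{m,n}$ has $m$ cells and $n$ items, with $h_1,\dots,h_n$ i.i.d. uniform on $\{1,\dots,m\}$. For $\Xi\in\{\mathsf L,\mathsf E\}$,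 $d_i^\Xi(\mathcal T)$ is the final displacement of item $x_i$, i.e. the number of links one has to follow from $h_i$ until $x_i$ is found in the final table (built with policy $\Xi$); $n_k^\Xi(\mathcal T):=\#\{i: d_i^\Xi(\mathcal T)=k\}$; and, if $n>0$, $d^\Xi(\mathcal T):=d_I^\Xi(\mathcal T)$ where $I$ is uniform on $\{1,\dots,n\}$, independent of $\mathcal T$. For an unsuccessful search starting at cell $j$, $d_j^{\mathsf U}(\mathcal T)$ is the number of occupied cells encountered: $0$ if cell $j$ is empty, and otherwise $1$ plus the number of cells after $j$ in its chain. Put $n_k^{\mathsf U}(\mathcal T):=\#\{j: d_j^{\mathsf U}(\mathcal T)=k\}$ (the same for both policies) and $d^{\mathsf U}(\mathcal T):=d_J^{\mathsf U}(\mathcal T)$ where $J$ is uniform on $\{1,\dots,m\}$, independent of $\mathcal T$. *)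

theory Defs
  imports "HOL-Probability.Probability"
begin

section \<open>Hashing with coalesced chains\<close>

datatype policy = Late | Early

text \<open>
  The cells are \<open>1, \<dots>, m\<close>. The items are numbered from 0, so that the item \<open>i\<close> has the hash
  address \<open>hs ! i\<close>; the list \<open>hs\<close> encodes both \<open>n = length hs\<close> and the hash addresses.
  An empty cell has content \<open>None\<close>, a null link is \<open>None\<close>.
\<close>

record table =
  content :: "nat \<Rightarrow> nat option"
  link :: "nat \<Rightarrow> nat option"

definition empty_table :: table where
  "empty_table = \<lparr>content = (\<lambda>_. None), link = (\<lambda>_. None)\<rparr>"

text \<open>The cell reached from \<open>c\<close> by following exactly \<open>t\<close> links, if there is one.\<close>

primrec walk :: "(nat \<Rightarrow> nat option) \<Rightarrow> nat \<Rightarrow> nat \<Rightarrow> nat option" where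
  "walk lk c 0 = Some c"
| "walk lk c (Suc t) = Option.bind (walk lk c t) lk"

text \<open>The description is proper whenever the links form no cycle, as in every table built below.\<close>

definition chain_end :: "(nat \<Rightarrow> nat option) \<Rightarrow> nat \<Rightarrow> nat" where
  "chain_end lk c = (THE e. (\<exists>t. walk lk c t = Some e) \<and> lk e = None)"

text \<open>
  In the second case an empty cell exists as long as fewer than \<open>m\<close> items have been inserted.
  The link of an empty cell is null, so the late policy need not set the link of \<open>j\<close>.
\<close>

definition insert_item :: "policy \<Rightarrow> nat \<Rightarrow> nat \<Rightarrow> nat \<Rightarrow> table \<Rightarrow> table" where
  "insert_item P m i h T =
     (if content T h = None then T\<lparr>content := (content T)(h := Some i)\<rparr>
      else let j = Max {j \<in> {1..m}. content T j = None} in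
        \<lparr>content = (content T)(j := Some i),
         link = (case P of
             Late \<Rightarrow> (link T)(chain_end (link T) h := Some j)
           | Early \<Rightarrow> (link T)(j := link T h, h := Some j))\<rparr>)"

definition final_table :: "policy \<Rightarrow> nat \<Rightarrow> nat list \<Rightarrow> table" where
  "final_table P m hs = fold (\<lambda>(i, h). insert_item P m i h) (List.enumerate 0 hs) empty_table"

definition displacement :: "policy \<Rightarrow> nat \<Rightarrow> nat list \<Rightarrow> nat \<Rightarrow> nat" where
  "displacement P m hs i = (let T = final_table P m hs in
     LEAST t. \<exists>c. walk (link T) (hs ! i) t = Some c \<and> content T c = Some i)"

definition num_displaced :: "policy \<Rightarrow> nat \<Rightarrow> nat list \<Rightarrow> nat \<Rightarrow> nat" where
  "num_displaced P m hs k = card {i \<in> {..<length hs}. displacement P m hs i = k}"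

text \<open>
  The number of occupied cells seen by an unsuccessful search from a single cell \<open>j\<close> may depend
  on the order within the chain, so the policy is a parameter here too; only the number of cells
  \<open>j\<close> with a given value is the same for both policies.
\<close>

definition unsuccessful :: "policy \<Rightarrow> nat \<Rightarrow> nat list \<Rightarrow> nat \<Rightarrow> nat" where
  "unsuccessful P m hs j = (let T = final_table P m hs in
     if content T j = None then 0
     else 1 + card {c. \<exists>t>0. walk (link T) j t = Some c})"

definition num_unsuccessful :: "policy \<Rightarrow> nat \<Rightarrow> nat list \<Rightarrow> nat \<Rightarrow> nat" where
  "num_unsuccessful P m hs k = card {j \<in> {1..m}. unsuccessful P m hs j = k}"


section \<open>The random hash table\<close>

definition random_hashes :: "nat \<Rightarrow> nat \<Rightarrow> nat list pmf" where
  "random_hashes m n = replicate_pmf n (pmf_of_set {1..m})"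

text \<open>The distributions of the displacement of a random item and of a random unsuccessful search.\<close>

definition random_displacement :: "policy \<Rightarrow> nat \<Rightarrow> nat \<Rightarrow> nat pmf" where
  "random_displacement P m n =
     map_pmf (\<lambda>(hs, i). displacement P m hs i) (pair_pmf (random_hashes m n) (pmf_of_set {..<n}))"

definition random_unsuccessful :: "policy \<Rightarrow> nat \<Rightarrow> nat \<Rightarrow> nat pmf" where
  "random_unsuccessful P m n =
     map_pmf (\<lambda>(hs, j). unsuccessful P m hs j) (pair_pmf (random_hashes m n) (pmf_of_set {1..m}))"


section \<open>The limit distributions\<close>

definition p_U :: "real \<Rightarrow> nat \<Rightarrow> real" where
  "p_U \<alpha> k = (if k = 0 then 1 - \<alpha>
     else integral {0..\<alpha>} (\<lambda>t. (1 - \<alpha> + t) * (1 - exp (- t)) ^ (k - 1)))"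

definition p_L :: "real \<Rightarrow> nat \<Rightarrow> real" where
  "p_L \<alpha> k = (if k = 0 then 1 - \<alpha> / 2
     else if \<alpha> = 0 then 0
     else 1 / \<alpha> * integral {0..\<alpha>} (\<lambda>t. (\<alpha> - t - (\<alpha> - t)\<^sup>2 / 2) * (1 - exp (- t)) ^ (k - 1)))"

definition p_E :: "real \<Rightarrow> nat \<Rightarrow> real" where
  "p_E \<alpha> k = (if k = 0 then 1 - \<alpha> / 2
     else if \<alpha> = 0 then 0
     else 1 / \<alpha> * integral {0..\<alpha>} (\<lambda>t. (\<alpha> - t) * exp (- t) * (1 - exp (- t)) ^ (k - 1)))"

definition probability_distribution :: "(nat \<Rightarrow> real) \<Rightarrow> bool" where
  "probability_distribution p \<longleftrightarrow> (\<forall>k. 0 \<le> p k) \<and> p sums 1"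


section \<open>Convergence in distribution and of moments\<close>

definition converges_in_distribution :: "(nat \<Rightarrow> nat pmf) \<Rightarrow> nat pmf \<Rightarrow> bool" where
  "converges_in_distribution X D \<longleftrightarrow>
     weak_conv_m (\<lambda>N. distr (measure_pmf (X N)) borel real) (distr (measure_pmf D) borel real)"

text \<open>
  \<open>x\<^sup>r\<close> for real \<open>r \<ge> 0\<close> with \<open>0\<^sup>0 = 1\<close>, whereas \<open>0 powr 0 = 0\<close>.
\<close>

definition real_power :: "nat \<Rightarrow> real \<Rightarrow> real" where
  "real_power x r = (if r = 0 then 1 else real x powr r)"

text \<open>Integrability is required explicitly, since the integral of a non-integrable function is 0.\<close>

definition all_moments_converge :: "(nat \<Rightarrow> nat pmf) \<Rightarrow> nat pmf \<Rightarrow> bool" where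
  "all_moments_converge X D \<longleftrightarrow>
     (\<forall>r\<ge>0. (\<forall>N. integrable (measure_pmf (X N)) (\<lambda>x. real_power x r)) \<and>
       integrable (measure_pmf D) (\<lambda>x. real_power x r) \<and>
       (\<lambda>N. measure_pmf.expectation (X N) (\<lambda>x. real_power x r))
         \<longlonglongrightarrow> measure_pmf.expectation D (\<lambda>x. real_power x r))"

end

theory Submission
  imports Defs
begin

text \<open>
  Let \<open>C\<^sub>k\<close> be the expected number of cells with unsuccessful search length \<open>k \<ge> 1\<close>, which is the
  expected number of chains of length at least \<open>k\<close>; a new item makes it grow by one exactly when it
  hits a chain of length \<open>k - 1\<close>, so \<open>C\<^sub>k\<close> increases by \<open>(k - 1) (C\<^bsub>k-1\<^esub> - C\<^sub>k) / m\<close> per insertion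
  (and \<open>C\<^sub>1\<close> by the probability of an empty cell). A late-inserted item keeps the displacement given
  by the unsuccessful search at its insertion. An early-inserted item of displacement \<open>d\<close> is pushed
  one cell further exactly when one of the \<open>d\<close> cells before it on its path is hit, so the expected
  numbers \<open>V\<^sub>k\<close> increase by \<open>((k - 1) V\<^bsub>k-1\<^esub> - k V\<^sub>k) / m\<close>. These recurrences are Euler schemes with
  step \<open>1 / m\<close> of linear differential equations of Yule type, solved by the integrals in the theorem.
  The rising factorials \<open>k (k + 1) \<dots> (k + r - 1)\<close> are eigenvectors of the recurrences, so all moments
  stay bounded; dominated convergence of series then gives total mass one, convergence in
  distribution and convergence of moments.
\<close>

section \<open>The chains of a hash table\<close>

primrec linked :: "('a \<Rightarrow> 'a option) \<Rightarrow> 'a list \<Rightarrow> bool" where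
  "linked lk [] = True"
| "linked lk (x # xs) = (lk x = (case xs of [] \<Rightarrow> None | y # _ \<Rightarrow> Some y) \<and> linked lk xs)"

lemma linked_cong: "(\<And>x. x \<in> set xs \<Longrightarrow> lk x = lk' x) \<Longrightarrow> linked lk xs = linked lk' xs"
  by (induction xs) auto

text \<open>The new cell inherits the old link of \<open>last u\<close>, which is the head of
  \<open>v\<close> or null, so appending at the end and inserting in the middle need no separate
  treatment. Distinctness keeps the two updates away from the other cells of the list.\<close>

lemma linked_splice:
  assumes "linked lk (u @ v)" "u \<noteq> []" "distinct (u @ v)" "j \<notin> set (u @ v)"
    and "lk' j = lk (last u)" "lk' (last u) = Some j" "\<And>c. c \<noteq> j \<Longrightarrow> c \<noteq> last u \<Longrightarrow> lk' c = lk c"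
  shows "linked lk' (u @ j # v)"
  using assms
proof (induction u)
  case Nil
  then show ?case by simp
next
  case (Cons x u)
  show ?case
  proof (cases u)
    case Nil
    have "linked lk' v = linked lk v"
      by (intro linked_cong Cons.prems(7)) (use Cons.prems Nil in auto)
    then show ?thesis using Cons.prems Nil by auto
  next
    case (Cons y w)
    have *: "linked lk' (u @ j # v)"
      using Cons.IH Cons.prems Cons by auto
    have "last u \<in> set u" using Cons by auto
    then have "lk' x = lk x" by (intro Cons.prems(7)) (use Cons.prems in auto)
    then show ?thesis using * Cons.prems(1) Cons by simp
  qed
qed

lemma linked_nth:
  "linked lk xs \<Longrightarrow> i < length xs \<Longrightarrow> lk (xs ! i) = (if Suc i < length xs then Some (xs ! Suc i) else None)"
proof (induction xs arbitrary: i)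
  case (Cons x xs)
  then show ?case by (cases i; cases xs) auto
qed simp

lemma walk_linked:
  "linked lk xs \<Longrightarrow> i < length xs
    \<Longrightarrow> walk lk (xs ! i) t = (if i + t < length xs then Some (xs ! (i + t)) else None)"
  by (induction t) (auto simp: linked_nth)

lemma chain_end_linked:
  assumes "linked lk xs" "x \<in> set xs"
  shows "chain_end lk x = last xs"
proof -
  obtain i where i: "i < length xs" "x = xs ! i" using assms(2) by (auto simp: in_set_conv_nth)
  have last: "last xs = xs ! (length xs - 1)" using assms(2) by (metis last_conv_nth empty_iff list.set(1))
  show ?thesis unfolding chain_end_def
  proof (rule the_equality)
    have "walk lk x (length xs - 1 - i) = Some (last xs)"
      using walk_linked[OF assms(1) i(1)] i last by auto
    moreover have "lk (last xs) = None"
      using linked_nth[OF assms(1), of "length xs - 1"] i last by auto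
    ultimately show "(\<exists>t. walk lk x t = Some (last xs)) \<and> lk (last xs) = None" by blast
  next
    fix e assume e: "(\<exists>t. walk lk x t = Some e) \<and> lk e = None"
    then obtain t where t: "walk lk x t = Some e" by blast
    then have t': "i + t < length xs" "e = xs ! (i + t)"
      using walk_linked[OF assms(1) i(1), of t] i by (auto split: if_splits)
    then have "\<not> Suc (i + t) < length xs" using e linked_nth[OF assms(1) t'(1)] by auto
    then have "i + t = length xs - 1" using t' by auto
    then show "e = last xs" using t' last by simp
  qed
qed

lemma card_reachable:
  assumes "linked lk xs" "distinct xs" "i < length xs"
  shows "card {c. \<exists>t>0. walk lk (xs ! i) t = Some c} = length xs - Suc i"
proof -
  have "{c. \<exists>t>0. walk lk (xs ! i) t = Some c} = (!) xs ` {Suc i..<length xs}"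
  proof (intro equalityI subsetI)
    fix c assume "c \<in> {c. \<exists>t>0. walk lk (xs ! i) t = Some c}"
    then show "c \<in> (!) xs ` {Suc i..<length xs}"
      using walk_linked[OF assms(1,3)] by (auto split: if_splits)
  next
    fix c assume "c \<in> (!) xs ` {Suc i..<length xs}"
    then obtain r where r: "Suc i \<le> r" "r < length xs" "c = xs ! r" by auto
    then have "walk lk (xs ! i) (r - i) = Some c" "r - i > 0" using walk_linked[OF assms(1,3)] by auto
    then show "c \<in> {c. \<exists>t>0. walk lk (xs ! i) t = Some c}" by blast
  qed
  moreover have "inj_on ((!) xs) {Suc i..<length xs}"
    using assms(2) by (auto intro!: inj_onI simp: nth_eq_iff_index_eq)
  ultimately show ?thesis by (simp add: card_image)
qed

text \<open>
  The item \<open>i\<close> sits in position \<open>q\<close> of the chain \<open>xs\<close>, and its search starts from position \<open>p\<close>.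
\<close>

definition located :: "nat list \<Rightarrow> table \<Rightarrow> nat list list \<Rightarrow> nat \<Rightarrow> nat list \<Rightarrow> nat \<Rightarrow> nat \<Rightarrow> bool" where
  "located hs T L i xs p q \<longleftrightarrow> xs \<in> set L \<and> p \<le> q \<and> q < length xs \<and> xs ! p = hs ! i \<and>
     content T (xs ! q) = Some i \<and> (\<forall>c. content T c = Some i \<longrightarrow> c = xs ! q)"

text \<open>The invariant of the construction. The lists of \<open>L\<close> are disjoint and cover
  the occupied cells; as all other cells have null links, each nonempty list is a whole chain. The
  bound on the range of \<open>content T\<close> makes \<open>length hs\<close> a fresh label for
  the next item.\<close>

definition chain_table :: "nat \<Rightarrow> nat list \<Rightarrow> table \<Rightarrow> nat list list \<Rightarrow> bool" where
  "chain_table m hs T L \<longleftrightarrow>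
     distinct (concat L) \<and> length (concat L) = length hs \<and>
     set (concat L) = {c. content T c \<noteq> None} \<and> set (concat L) \<subseteq> {1..m} \<and>
     (\<forall>xs\<in>set L. linked (link T) xs) \<and> (\<forall>c. c \<notin> set (concat L) \<longrightarrow> link T c = None) \<and>
     ran (content T) \<subseteq> {..<length hs} \<and>
     (\<forall>i<length hs. \<exists>xs p q. located hs T L i xs p q)"

lemma chain_tableD:
  assumes "chain_table m hs T L"
  shows "distinct (concat L)" "length (concat L) = length hs"
    "set (concat L) = {c. content T c \<noteq> None}" "set (concat L) \<subseteq> {1..m}"
    "xs \<in> set L \<Longrightarrow> linked (link T) xs" "c \<notin> set (concat L) \<Longrightarrow> link T c = None"
    "ran (content T) \<subseteq> {..<length hs}"
    "i < length hs \<Longrightarrow> \<exists>xs p q. located hs T L i xs p q"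
  using assms unfolding chain_table_def by blast+

lemma locatedD:
  assumes "located hs T L i xs p q"
  shows "xs \<in> set L" "p \<le> q" "q < length xs" "xs ! p = hs ! i"
    "content T c = Some i \<longleftrightarrow> c = xs ! q"
  using assms unfolding located_def by blast+

section \<open>Displacements and search lengths as differences of positions\<close>

lemma final_table_snoc:
  "final_table P m (hs @ [h]) = insert_item P m (length hs) h (final_table P m hs)"
  by (simp add: final_table_def enumerate_append_eq)

lemma displacement_located:
  assumes "chain_table m hs (final_table P m hs) L" "located hs (final_table P m hs) L i xs p q"
  shows "displacement P m hs i = q - p"
proof -
  let ?T = "final_table P m hs"
  note pq = locatedD(2-4)[OF assms(2)] and c = locatedD(5)[OF assms(2)]
    and lk = chain_tableD(5)[OF assms(1) locatedD(1)[OF assms(2)]]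
  have d: "distinct xs" using chain_tableD(1)[OF assms(1)] locatedD(1)[OF assms(2)]
    by (simp add: distinct_concat_iff)
  have w: "walk (link ?T) (hs ! i) t = (if p + t < length xs then Some (xs ! (p + t)) else None)" for t
    using walk_linked[OF lk, of p t] pq by simp
  show ?thesis unfolding displacement_def Let_def
  proof (rule Least_equality)
    show "\<exists>c. walk (link ?T) (hs ! i) (q - p) = Some c \<and> content ?T c = Some i"
      using w[of "q - p"] pq c by auto
  next
    fix t assume "\<exists>c. walk (link ?T) (hs ! i) t = Some c \<and> content ?T c = Some i"
    then have "p + t < length xs" "xs ! (p + t) = xs ! q" using w[of t] c by (auto split: if_splits)
    then show "q - p \<le> t" using d pq by (auto simp: nth_eq_iff_index_eq)
  qed
qed

lemma unsuccessful_chain: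
  assumes "chain_table m hs (final_table P m hs) L" "xs \<in> set L" "i < length xs"
  shows "unsuccessful P m hs (xs ! i) = length xs - i"
proof -
  let ?T = "final_table P m hs"
  have "xs ! i \<in> set (concat L)" using assms(2,3) by (auto intro!: bexI[of _ xs])
  then have "content ?T (xs ! i) \<noteq> None" unfolding chain_tableD(3)[OF assms(1)] by simp
  moreover have "linked (link ?T) xs" "distinct xs"
    using chain_tableD(1,5)[OF assms(1)] assms(2) by (auto simp: distinct_concat_iff)
  ultimately show ?thesis using card_reachable[of "link ?T" xs i] assms(3)
    by (simp add: unsuccessful_def Let_def)
qed

section \<open>Inserting an item: splicing into a chain or starting a new one\<close>

text \<open>Positions from \<open>length u\<close> onwards shift by one and the earlier ones stay.
  Hence \<open>q - p\<close> grows by one exactly when \<open>p < length u \<le> q\<close>, that is,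
  when the new cell lands between the start of the search and the item.\<close>

lemma located_splice:
  assumes L: "chain_table m hs T (A @ (u @ v) # B)" and u: "h \<in> set u"
    and j: "content T j = None"
    and T': "content T' = (content T)(j := Some (length hs))"
    and loc: "located hs T (A @ (u @ v) # B) i xs p q" and i: "i < length hs"
  shows "located (hs @ [h]) T' (A @ (u @ j # v) # B) i (if xs = u @ v then u @ j # v else xs)
    (if xs = u @ v \<and> length u \<le> p then Suc p else p) (if xs = u @ v \<and> length u \<le> q then Suc q else q)"
proof -
  have c: "content T' c = Some i \<longleftrightarrow> c = xs ! q" for c
    using locatedD(5)[OF loc, of c] locatedD(5)[OF loc, of "xs ! q"] i j by (auto simp: T')
  have hsi: "(hs @ [h]) ! i = hs ! i" using i by (simp add: nth_append)
  show ?thesis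
  proof (cases "xs = u @ v")
    case True
    define s where "s r = (if length u \<le> r then Suc r else r)" for r
    have sh: "(u @ j # v) ! s r = (u @ v) ! r" for r
      by (simp add: s_def nth_append Suc_diff_le)
    have "located (hs @ [h]) T' (A @ (u @ j # v) # B) i (u @ j # v) (s p) (s q)"
      using locatedD(2-4)[OF loc] c hsi unfolding located_def sh True by (auto simp: s_def)
    then show ?thesis using True by (simp add: s_def)
  next
    case False
    then have "xs \<in> set (A @ (u @ j # v) # B)" using locatedD(1)[OF loc] by simp
    then show ?thesis using False locatedD(2-4)[OF loc] c hsi unfolding located_def by auto
  qed
qed

text \<open>
  Both policies splice the new cell into a chain: after its last cell, or after the hash address.
\<close>

lemma chain_table_splice:
  assumes L: "chain_table m hs T (A @ (u @ v) # B)" and u: "h \<in> set u"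
    and j: "content T j = None" "j \<in> {1..m}"
    and T': "content T' = (content T)(j := Some (length hs))"
      "link T' = (link T)(j := link T (last u), last u := Some j)"
  shows "chain_table m (hs @ [h]) T' (A @ (u @ j # v) # B)"
    and "\<exists>p<length u. u ! p = h \<and>
      located (hs @ [h]) T' (A @ (u @ j # v) # B) (length hs) (u @ j # v) p (length u)"
proof -
  note occ = chain_tableD(3)[OF L] and dist = chain_tableD(1)[OF L] and ran = chain_tableD(7)[OF L]
  then have jn: "j \<notin> set (concat (A @ (u @ v) # B))" using j by blast
  have last: "last u \<in> set u" using u by (metis last_in_set empty_iff list.set(1))
  obtain p where p: "p < length u" "u ! p = h" using u by (auto simp: in_set_conv_nth)
  \<comment> \<open>By the bound on \<open>ran (content T)\<close> no old cell carries the label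
    \<open>length hs\<close>, so \<open>j\<close> is the only cell holding the new item.\<close>
  have new: "located (hs @ [h]) T' (A @ (u @ j # v) # B) (length hs) (u @ j # v) p (length u)"
    unfolding located_def using p ran by (auto simp: T' nth_append ran_def)
  show "\<exists>p<length u. u ! p = h \<and>
      located (hs @ [h]) T' (A @ (u @ j # v) # B) (length hs) (u @ j # v) p (length u)"
    using new p by blast
  have lnk: "linked (link T') xs" if "xs \<in> set (A @ (u @ j # v) # B)" for xs
  proof (cases "xs = u @ j # v")
    case True
    then have "linked (link T) (u @ v)" using chain_tableD(5)[OF L] by simp
    moreover have "last u \<noteq> j" using last jn by auto
    ultimately show ?thesis unfolding True using dist jn u
      by (intro linked_splice[of "link T"]) (auto simp: T')
  next
    case False
    then have xs: "xs \<in> set A \<union> set B" using that by auto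
    have "linked (link T') xs = linked (link T) xs"
    proof (rule linked_cong)
      fix x assume x: "x \<in> set xs"
      have "x \<noteq> j" using x xs jn by auto
      moreover have "x \<noteq> last u" using x xs last dist by auto
      ultimately show "link T' x = link T x" by (simp add: T')
    qed
    then show ?thesis using chain_tableD(5)[OF L] xs by auto
  qed
  have items: "\<exists>xs p q. located (hs @ [h]) T' (A @ (u @ j # v) # B) i xs p q" if "i < length (hs @ [h])" for i
  proof (cases "i = length hs")
    case True
    then show ?thesis using new by blast
  next
    case False
    then have i: "i < length hs" using that by simp
    then obtain xs p q where "located hs T (A @ (u @ v) # B) i xs p q" using chain_tableD(8)[OF L] by blast
    from located_splice[OF L u j(1) T'(1) this i] show ?thesis by blast
  qed
  have 1: "distinct (concat (A @ (u @ j # v) # B))" using dist jn by auto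
  have 2: "length (concat (A @ (u @ j # v) # B)) = length (hs @ [h])"
    using chain_tableD(2)[OF L] by simp
  have 3: "set (concat (A @ (u @ j # v) # B)) = insert j (set (concat (A @ (u @ v) # B)))" by auto
  have 4: "{c. content T' c \<noteq> None} = insert j {c. content T c \<noteq> None}" by (auto simp: T')
  note 5 = chain_tableD(4)[OF L]
  have 6: "link T' c = None" if "c \<notin> set (concat (A @ (u @ j # v) # B))" for c
  proof -
    have "c \<noteq> j" "c \<noteq> last u" using that last by auto
    then show ?thesis using chain_tableD(6)[OF L, of c] that by (auto simp: T')
  qed
  have 7: "ran (content T') \<subseteq> {..<length (hs @ [h])}" using ran by (auto simp: T' ran_def split: if_splits)
  show "chain_table m (hs @ [h]) T' (A @ (u @ j # v) # B)"
    unfolding chain_table_def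
  proof (intro conjI)
    show "set (concat (A @ (u @ j # v) # B)) = {c. content T' c \<noteq> None}" using 3 4 occ by simp
    show "set (concat (A @ (u @ j # v) # B)) \<subseteq> {1..m}" using 3 5 j by simp
  qed (use 1 2 6 7 lnk items in blast)+
qed

lemma chain_table_singleton:
  assumes L: "chain_table m hs T L" and h: "content T h = None" "h \<in> {1..m}"
    and T': "content T' = (content T)(h := Some (length hs))" "link T' = link T"
  shows "chain_table m (hs @ [h]) T' ([h] # L)"
    and "located (hs @ [h]) T' ([h] # L) (length hs) [h] 0 0"
    and "i < length hs \<Longrightarrow> located hs T L i xs p q \<Longrightarrow> located (hs @ [h]) T' ([h] # L) i xs p q"
proof -
  note ran = chain_tableD(7)[OF L] and occ = chain_tableD(3)[OF L]
  show new: "located (hs @ [h]) T' ([h] # L) (length hs) [h] 0 0"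
    using ran by (auto simp: located_def T' ran_def)
  have old: "located (hs @ [h]) T' ([h] # L) i xs p q"
    if "i < length hs" "located hs T L i xs p q" for i xs p q
  proof -
    have "content T' c = Some i \<longleftrightarrow> c = xs ! q" for c
      using locatedD(5)[OF that(2), of c] locatedD(5)[OF that(2), of "xs ! q"] that(1) h by (auto simp: T')
    then show ?thesis using locatedD(1-4)[OF that(2)] that(1) by (auto simp: located_def nth_append)
  qed
  then show "i < length hs \<Longrightarrow> located hs T L i xs p q \<Longrightarrow> located (hs @ [h]) T' ([h] # L) i xs p q" .
  have items: "\<exists>xs p q. located (hs @ [h]) T' ([h] # L) i xs p q" if "i < length (hs @ [h])" for i
  proof (cases "i = length hs")
    case True
    then show ?thesis using new by blast
  next
    case False
    then have i: "i < length hs" using that by simp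
    then obtain xs p q where "located hs T L i xs p q" using chain_tableD(8)[OF L] by blast
    from old[OF i this] show ?thesis by blast
  qed
  have hn: "h \<notin> set (concat L)" unfolding occ using h by simp
  have 4: "{c. content T' c \<noteq> None} = insert h {c. content T c \<noteq> None}" by (auto simp: T')
  have 7: "ran (content T') \<subseteq> {..<length (hs @ [h])}" using ran by (auto simp: T' ran_def split: if_splits)
  show "chain_table m (hs @ [h]) T' ([h] # L)"
    unfolding chain_table_def
  proof (intro conjI)
    show "set (concat ([h] # L)) = {c. content T' c \<noteq> None}" using 4 occ by simp
    show "set (concat ([h] # L)) \<subseteq> {1..m}" "distinct (concat ([h] # L))"
      "length (concat ([h] # L)) = length (hs @ [h])"
      "\<forall>xs\<in>set ([h] # L). linked (link T') xs"
      "\<forall>c. c \<notin> set (concat ([h] # L)) \<longrightarrow> link T' c = None"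
      using chain_tableD(1,2,4,5,6)[OF L] h hn by (auto simp: T')
  qed (use 7 items in blast)+
qed

text \<open>Brings both policies into the form that \<open>chain_table_splice\<close> expects. For
  the late policy \<open>u\<close> is the whole chain; for the early one \<open>u\<close> ends at
  the hash address.\<close>

lemma insert_item_splice:
  assumes L: "chain_table m hs T (A @ xs # B)" and h: "h \<in> set xs" and n: "length hs < m"
  obtains u v j where "xs = u @ v" "h \<in> set u" "P = Late \<Longrightarrow> v = []" "P = Early \<Longrightarrow> last u = h"
    "content T j = None" "j \<in> {1..m}"
    "content (insert_item P m (length hs) h T) = (content T)(j := Some (length hs))"
    "link (insert_item P m (length hs) h T) = (link T)(j := link T (last u), last u := Some j)"
proof -
  define j where "j = Max {j \<in> {1..m}. content T j = None}"
  note occ = chain_tableD(3)[OF L]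
  \<comment> \<open>Pigeonhole: a full table would hold \<open>m\<close> items, but only
    \<open>length hs < m\<close> have been placed. So \<open>Max\<close> is taken over a nonempty
    set and \<open>j\<close> is an empty cell.\<close>
  have "{j \<in> {1..m}. content T j = None} \<noteq> {}"
  proof
    assume "{j \<in> {1..m}. content T j = None} = {}"
    then have "{1..m} \<subseteq> set (concat (A @ xs # B))" unfolding occ by auto
    then have "m \<le> card (set (concat (A @ xs # B)))" by (metis card_atLeastAtMost card_mono List.finite_set diff_Suc_1)
    also have "\<dots> \<le> length hs" using chain_tableD(2)[OF L] card_length[of "concat (A @ xs # B)"] by simp
    finally show False using n by simp
  qed
  then have "j \<in> {j \<in> {1..m}. content T j = None}" unfolding j_def by (intro Max_in) auto
  then have j: "content T j = None" "j \<in> {1..m}" by auto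
  then have "j \<notin> set (concat (A @ xs # B))" unfolding occ by simp
  then have lj: "link T j = None" using chain_tableD(6)[OF L] by blast
  have "h \<in> {c. content T c \<noteq> None}" using h unfolding occ[symmetric] by simp
  then have hT: "content T h \<noteq> None" by simp
  have lk: "linked (link T) xs" using chain_tableD(5)[OF L] by simp
  have ins: "insert_item P m (length hs) h T = \<lparr>content = (content T)(j := Some (length hs)),
      link = (case P of Late \<Rightarrow> (link T)(chain_end (link T) h := Some j)
        | Early \<Rightarrow> (link T)(j := link T h, h := Some j))\<rparr>"
    by (simp only: insert_item_def hT Let_def j_def if_False)
  show ?thesis
  proof (cases P)
    case Late
    have "xs \<noteq> []" using h by auto
    then have "link T (last xs) = None" using linked_nth[OF lk, of "length xs - 1"] by (simp add: last_conv_nth)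
    \<comment> \<open>The late policy does not write the link of \<open>j\<close>. This link and
      that of the chain end are both null, so the extra update of the splice form changes
      nothing.\<close>
    then have "(link T)(j := link T (last xs)) = link T" using lj by (simp add: fun_upd_idem)
    then show ?thesis using Late h j hT chain_end_linked[OF lk h]
      by (intro that[of xs "[]" j]) (auto simp: ins[unfolded Late])
  next
    case Early
    obtain a b where "xs = a @ h # b" using h by (meson split_list)
    then show ?thesis using Early h j hT
      by (intro that[of "a @ [h]" b j]) (auto simp: ins[unfolded Early])
  qed
qed

lemma chain_table_exists:
  "set hs \<subseteq> {1..m} \<Longrightarrow> length hs \<le> m \<Longrightarrow> \<exists>L. chain_table m hs (final_table P m hs) L"
proof (induction hs rule: rev_induct)
  case Nil
  then show ?case by (intro exI[of _ "[]"]) (simp add: chain_table_def final_table_def empty_table_def)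
next
  case (snoc h hs)
  let ?T = "final_table P m hs"
  obtain L where L: "chain_table m hs ?T L" using snoc by auto
  show ?case
  proof (cases "content ?T h")
    case None
    have "chain_table m (hs @ [h]) (insert_item P m (length hs) h ?T) ([h] # L)"
      by (rule chain_table_singleton(1)[OF L None]) (use None snoc.prems in \<open>auto simp: insert_item_def\<close>)
    then show ?thesis unfolding final_table_snoc by blast
  next
    case (Some i)
    then have "h \<in> set (concat L)" unfolding chain_tableD(3)[OF L] by simp
    then obtain xs where xs: "xs \<in> set L" "h \<in> set xs" by auto
    then obtain A B where AB: "L = A @ xs # B" by (meson split_list)
    obtain u v j where uv: "xs = u @ v" "h \<in> set u" "content ?T j = None" "j \<in> {1..m}"
      "content (insert_item P m (length hs) h ?T) = (content ?T)(j := Some (length hs))"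
      "link (insert_item P m (length hs) h ?T) = (link ?T)(j := link ?T (last u), last u := Some j)"
      using insert_item_splice[OF L[unfolded AB] xs(2), of P] snoc.prems by (metis length_append_singleton Suc_le_eq)
    show ?thesis unfolding final_table_snoc
      using chain_table_splice(1)[OF L[unfolded AB uv(1)] uv(2-6)] by blast
  qed
qed

section \<open>The effect of one insertion\<close>

lemma sum_concat_const:
  fixes G :: "'a list \<Rightarrow> real"
  assumes "distinct (concat L)" "\<And>xs x. xs \<in> set L \<Longrightarrow> x \<in> set xs \<Longrightarrow> g x = G xs"
  shows "sum g (set (concat L)) = (\<Sum>xs\<leftarrow>L. real (length xs) * G xs)"
  using assms
proof (induction L)
  case (Cons xs L)
  have "sum g (set (concat (xs # L))) = sum g (set xs) + sum g (set (concat L))"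
    using Cons.prems(1) by (simp add: sum.union_disjoint)
  also have "sum g (set xs) = (\<Sum>x\<in>set xs. G xs)"
    using Cons.prems(2) by (intro sum.cong) auto
  also have "\<dots> = real (length xs) * G xs"
    using Cons.prems(1) by (simp add: distinct_card)
  finally show ?case using Cons by simp
qed simp

lemma unsuccessful_eq_0_iff: "unsuccessful P m hs j = 0 \<longleftrightarrow> content (final_table P m hs) j = None"
  by (simp add: unsuccessful_def Let_def)

lemma num_unsuccessful_0:
  assumes L: "chain_table m hs (final_table P m hs) L"
  shows "num_unsuccessful P m hs 0 = m - length hs"
proof -
  have "{j \<in> {1..m}. unsuccessful P m hs j = 0} = {1..m} - set (concat L)"
    unfolding unsuccessful_eq_0_iff chain_tableD(3)[OF L] by auto
  moreover have "card (set (concat L)) = length hs"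
    using chain_tableD(1,2)[OF L] distinct_card by metis
  ultimately show ?thesis using chain_tableD(4)[OF L]
    by (simp only: num_unsuccessful_def card_Diff_subset[OF List.finite_set chain_tableD(4)[OF L]])
      simp
qed

text \<open>Along a chain of length \<open>l\<close> the search lengths \<open>l, ..., 1\<close>
  occur once each, whatever the order of its cells, so the chain contributes one cell exactly when
  \<open>k \<le> l\<close>. Only the lengths of the chains matter from here on.\<close>

lemma num_unsuccessful_pos:
  assumes L: "chain_table m hs (final_table P m hs) L" and k: "k > 0"
  shows "real (num_unsuccessful P m hs k) = (\<Sum>xs\<leftarrow>L. of_bool (k \<le> length xs))"
proof -
  have eq: "{j \<in> {1..m}. unsuccessful P m hs j = k} = {j \<in> set (concat L). unsuccessful P m hs j = k}"
    using chain_tableD(4)[OF L] k unfolding chain_tableD(3)[OF L]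
    by (auto simp: unsuccessful_eq_0_iff[of P m hs, symmetric])
  \<comment> \<open>The induction runs over lists \<open>M\<close> of chains of \<open>L\<close>,
    because \<open>unsuccessful_chain\<close> refers to the table, whose chains remain those of
    \<open>L\<close>.\<close>
  have "(\<Sum>j\<in>set (concat M). of_bool (unsuccessful P m hs j = k)) = (\<Sum>xs\<leftarrow>M. of_bool (k \<le> length xs) :: real)"
    if "distinct (concat M)" "set M \<subseteq> set L" for M
    using that
  proof (induction M)
    case (Cons xs M)
    have u: "unsuccessful P m hs (xs ! i) = length xs - i" if "i < length xs" for i
      using unsuccessful_chain[OF L _ that] Cons.prems(2) by simp
    have "(\<Sum>j\<in>set xs. of_bool (unsuccessful P m hs j = k) :: real)
      = (\<Sum>i<length xs. of_bool (unsuccessful P m hs (xs ! i) = k))"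
      using Cons.prems(1) by (intro sum.reindex_bij_betw[symmetric] bij_betw_nth) auto
    \<comment> \<open>The only candidate is the position \<open>length xs - k\<close>. If
      \<open>k > length xs\<close>, truncated subtraction gives position 0, where
      \<open>of_bool (k \<le> length xs)\<close> is 0.\<close>
    also have "\<dots> = (\<Sum>i<length xs. if i = length xs - k then of_bool (k \<le> length xs) else 0)"
      using k by (intro sum.cong) (auto simp: u)
    also have "\<dots> = of_bool (k \<le> length xs)"
      using k by (auto simp: sum.delta)
    finally have 1: "(\<Sum>j\<in>set xs. of_bool (unsuccessful P m hs j = k) :: real) = of_bool (k \<le> length xs)" .
    have "(\<Sum>j\<in>set (concat (xs # M)). of_bool (unsuccessful P m hs j = k) :: real)
      = (\<Sum>j\<in>set xs. of_bool (unsuccessful P m hs j = k)) + (\<Sum>j\<in>set (concat M). of_bool (unsuccessful P m hs j = k))"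
      using Cons.prems(1) by (simp add: sum.union_disjoint del: sum_of_bool_eq)
    then show ?case using Cons 1 by simp
  qed simp
  from this[of L] show ?thesis using chain_tableD(1)[OF L]
    unfolding num_unsuccessful_def eq by (simp add: Int_def)
qed

lemma num_displaced_sum:
  "real (num_displaced P m hs k) = (\<Sum>i<length hs. of_bool (displacement P m hs i = k))"
  by (simp add: num_displaced_def sum_of_bool_eq Int_def)

lemma num_unsuccessful_sum:
  "real (num_unsuccessful P m hs k) = (\<Sum>j\<in>{1..m}. of_bool (unsuccessful P m hs j = k))"
  by (simp add: num_unsuccessful_def sum_of_bool_eq Int_def)

section \<open>The exact change of the counts under one insertion\<close>

lemma chain_table_step_empty:
  assumes L: "chain_table m hs (final_table P m hs) L"
    and h: "content (final_table P m hs) h = None" "h \<in> {1..m}"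
  shows "chain_table m (hs @ [h]) (final_table P m (hs @ [h])) ([h] # L)"
    and "displacement P m (hs @ [h]) (length hs) = 0"
    and "i < length hs \<Longrightarrow> displacement P m (hs @ [h]) i = displacement P m hs i"
proof -
  let ?T' = "final_table P m (hs @ [h])"
  have T': "content ?T' = (content (final_table P m hs))(h := Some (length hs))"
    "link ?T' = link (final_table P m hs)"
    using h by (auto simp: final_table_snoc insert_item_def)
  note s = chain_table_singleton[OF L h T']
  show L': "chain_table m (hs @ [h]) ?T' ([h] # L)" by (rule s(1))
  show "displacement P m (hs @ [h]) (length hs) = 0" using displacement_located[OF L' s(2)] by simp
  assume i: "i < length hs"
  then obtain xs p q where loc: "located hs (final_table P m hs) L i xs p q" using chain_tableD(8)[OF L] by blast
  show "displacement P m (hs @ [h]) i = displacement P m hs i"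
    using displacement_located[OF L loc] displacement_located[OF L' s(3)[OF i loc]] by simp
qed

lemma chain_table_step_occupied:
  assumes L: "chain_table m hs (final_table P m hs) (A @ xs # B)"
    and h: "h \<in> set xs" and n: "length hs < m"
  obtains u v j where "xs = u @ v" "h \<in> set u" "P = Late \<Longrightarrow> v = []" "P = Early \<Longrightarrow> last u = h"
    "chain_table m (hs @ [h]) (final_table P m (hs @ [h])) (A @ (u @ j # v) # B)"
    "\<exists>p<length u. u ! p = h \<and> displacement P m (hs @ [h]) (length hs) = length u - p"
    "\<And>i ys p q. i < length hs \<Longrightarrow> located hs (final_table P m hs) (A @ xs # B) i ys p q \<Longrightarrow>
      displacement P m (hs @ [h]) i = q - p + of_bool (ys = xs \<and> p < length u \<and> length u \<le> q)"
proof -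
  obtain u v j where uv: "xs = u @ v" "h \<in> set u" "P = Late \<Longrightarrow> v = []" "P = Early \<Longrightarrow> last u = h"
    and j: "content (final_table P m hs) j = None" "j \<in> {1..m}"
    and T': "content (final_table P m (hs @ [h])) = (content (final_table P m hs))(j := Some (length hs))"
     "link (final_table P m (hs @ [h])) = (link (final_table P m hs))(j := link (final_table P m hs) (last u), last u := Some j)"
    using insert_item_splice[OF L h n, of P] unfolding final_table_snoc by metis
  note L0 = L[unfolded uv(1)]
  note s = chain_table_splice[OF L0 uv(2) j T']
  show ?thesis
  proof (rule that[OF uv s(1)])
    from s(2) obtain p where "p < length u" "u ! p = h"
      and loc: "located (hs @ [h]) (final_table P m (hs @ [h])) (A @ (u @ j # v) # B) (length hs) (u @ j # v) p (length u)"
      by blast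
    then show "\<exists>p<length u. u ! p = h \<and> displacement P m (hs @ [h]) (length hs) = length u - p"
      using displacement_located[OF s(1) loc] by blast
  next
    fix i ys p q assume i: "i < length hs" and loc: "located hs (final_table P m hs) (A @ xs # B) i ys p q"
    have "p \<le> q" using locatedD(2)[OF loc] .
    then show "displacement P m (hs @ [h]) i = q - p + of_bool (ys = xs \<and> p < length u \<and> length u \<le> q)"
      using displacement_located[OF s(1) located_splice[OF L0 uv(2) j(1) T'(1) loc[unfolded uv(1)] i]]
      by (auto simp: uv(1))
  qed
qed

text \<open>Summing over the \<open>m\<close> equally likely addresses gives \<open>m\<close> times
  the conditional mean after one more item. A chain of length \<open>k - 1\<close> is hit by
  \<open>k - 1\<close> addresses, each of which raises the count at level \<open>k\<close> by
  one.\<close>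

lemma sum_num_unsuccessful_snoc:
  assumes hs: "set hs \<subseteq> {1..m}" "length hs < m" and k: "k > 0"
  shows "(\<Sum>h\<in>{1..m}. real (num_unsuccessful P m (hs @ [h]) k)) =
    real m * num_unsuccessful P m hs k + of_bool (k = 1) * real (m - length hs)
    + real (k - 1) * (real (num_unsuccessful P m hs (k - 1)) - num_unsuccessful P m hs k)"
proof -
  let ?u = "\<lambda>hs. real (num_unsuccessful P m hs k)"
  obtain L where L: "chain_table m hs (final_table P m hs) L" using chain_table_exists[OF hs(1)] hs(2) by auto
  note occ = chain_tableD(3)[OF L]
  have empty: "?u (hs @ [h]) - ?u hs = of_bool (k = 1)" if "h \<in> {1..m} - set (concat L)" for h
  proof -
    have h: "content (final_table P m hs) h = None" "h \<in> {1..m}" using that unfolding occ by auto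
    show ?thesis unfolding num_unsuccessful_pos[OF chain_table_step_empty(1)[OF L h] k] num_unsuccessful_pos[OF L k]
      using k by auto
  qed
  have occupied: "?u (hs @ [h]) - ?u hs = of_bool (length xs = k - 1)" if xs: "xs \<in> set L" "h \<in> set xs" for xs h
  proof -
    obtain A B where AB: "L = A @ xs # B" using xs(1) by (meson split_list)
    obtain u v j where uv: "xs = u @ v" 
      "chain_table m (hs @ [h]) (final_table P m (hs @ [h])) (A @ (u @ j # v) # B)"
      using chain_table_step_occupied[OF L[unfolded AB] xs(2) hs(2)] by metis
    show ?thesis unfolding num_unsuccessful_pos[OF uv(2) k] num_unsuccessful_pos[OF L k] AB
      using k by (auto simp: uv(1))
  qed
  have "(\<Sum>h\<in>{1..m}. ?u (hs @ [h])) - real m * ?u hs = (\<Sum>h\<in>{1..m}. ?u (hs @ [h]) - ?u hs)"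
    by (simp add: sum_subtractf)
  also have "\<dots> = (\<Sum>h\<in>{1..m} - set (concat L). ?u (hs @ [h]) - ?u hs) + (\<Sum>h\<in>set (concat L). ?u (hs @ [h]) - ?u hs)"
    using chain_tableD(4)[OF L] by (intro sum.subset_diff) auto
  also have "(\<Sum>h\<in>{1..m} - set (concat L). ?u (hs @ [h]) - ?u hs) = (\<Sum>h\<in>{1..m} - set (concat L). of_bool (k = 1))"
    by (intro sum.cong empty refl)
  also have "\<dots> = of_bool (k = 1) * real (card ({1..m} - set (concat L)))" by simp
  also have "card ({1..m} - set (concat L)) = m - length hs"
    using card_Diff_subset[OF List.finite_set chain_tableD(4)[OF L]] distinct_card[OF chain_tableD(1)[OF L]]
      chain_tableD(2)[OF L] by simp
  also have "(\<Sum>h\<in>set (concat L). ?u (hs @ [h]) - ?u hs) = (\<Sum>xs\<leftarrow>L. real (length xs) * of_bool (length xs = k - 1))"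
    by (intro sum_concat_const chain_tableD(1)[OF L] occupied)
  \<comment> \<open>A length equals \<open>k - 1\<close> exactly when it is at least
    \<open>k - 1\<close> but not at least \<open>k\<close>; this expresses chains of one given
    length by the counts themselves.\<close>
  also have "\<dots> = (\<Sum>xs\<leftarrow>L. real (k - 1) * (of_bool (k - 1 \<le> length xs) - of_bool (k \<le> length xs)))"
    by (intro arg_cong[where f = sum_list] map_cong) (use k in auto)
  also have "\<dots> = real (k - 1) * ((\<Sum>xs\<leftarrow>L. of_bool (k - 1 \<le> length xs)) - (\<Sum>xs\<leftarrow>L. of_bool (k \<le> length xs)))"
    by (simp only: sum_list_const_mult sum_list_subtractf)
  \<comment> \<open>The case \<open>k = 1\<close> stands apart: the count at 0 is that of the empty
    cells, not of chains, but its factor \<open>k - 1\<close> vanishes.\<close>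
  also have "\<dots> = real (k - 1) * (real (num_unsuccessful P m hs (k - 1)) - ?u hs)"
    using num_unsuccessful_pos[OF L, of "k - 1"] num_unsuccessful_pos[OF L k] k by (cases "k = 1") auto
  finally show ?thesis by simp
qed

lemma sum_num_displaced_Late_snoc:
  assumes hs: "set hs \<subseteq> {1..m}" "length hs < m"
  shows "(\<Sum>h\<in>{1..m}. real (num_displaced Late m (hs @ [h]) k)) =
    real m * num_displaced Late m hs k + num_unsuccessful Late m hs k"
proof -
  obtain L where L: "chain_table m hs (final_table Late m hs) L" using chain_table_exists[OF hs(1)] hs(2) by auto
  have *: "(i < length hs \<longrightarrow> displacement Late m (hs @ [h]) i = displacement Late m hs i) \<and>
    displacement Late m (hs @ [h]) (length hs) = unsuccessful Late m hs h" if h: "h \<in> {1..m}" for h i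
  proof (cases "content (final_table Late m hs) h")
    case None
    then show ?thesis using chain_table_step_empty(2,3)[OF L None h] by (simp add: unsuccessful_eq_0_iff)
  next
    case (Some i')
    then have "h \<in> set (concat L)" unfolding chain_tableD(3)[OF L] by simp
    then obtain xs where xs: "xs \<in> set L" "h \<in> set xs" by auto
    then obtain A B where AB: "L = A @ xs # B" by (meson split_list)
    obtain p where p: "p < length xs" "xs ! p = h" "displacement Late m (hs @ [h]) (length hs) = length xs - p"
      and d: "\<And>i ys p q. i < length hs \<Longrightarrow> located hs (final_table Late m hs) L i ys p q \<Longrightarrow>
      displacement Late m (hs @ [h]) i = q - p + of_bool (ys = xs \<and> p < length xs \<and> length xs \<le> q)"
      using chain_table_step_occupied[OF L[unfolded AB] xs(2) hs(2)] unfolding AB by (metis append_Nil2)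
    have "displacement Late m (hs @ [h]) i = displacement Late m hs i" if i: "i < length hs"
    proof -
      obtain ys p q where loc: "located hs (final_table Late m hs) L i ys p q" using chain_tableD(8)[OF L i] by blast
      \<comment> \<open>The late policy cuts at the end of the chain, and every old item lies before
        it.\<close>
      have "\<not> (ys = xs \<and> p < length xs \<and> length xs \<le> q)" using locatedD(3)[OF loc] by auto
      then show ?thesis using displacement_located[OF L loc] d[OF i loc] by simp
    qed
    then show ?thesis using p unsuccessful_chain[OF L xs(1) p(1)] by simp
  qed
  have "(\<Sum>h\<in>{1..m}. real (num_displaced Late m (hs @ [h]) k)) =
    (\<Sum>h\<in>{1..m}. real (num_displaced Late m hs k) + of_bool (unsuccessful Late m hs h = k))"
    unfolding num_displaced_sum using * by (intro sum.cong refl) simp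
  then show ?thesis unfolding num_unsuccessful_sum by (simp add: sum.distrib)
qed

lemma sum_num_displaced_Early_snoc:
  assumes hs: "set hs \<subseteq> {1..m}" "length hs < m"
  shows "(\<Sum>h\<in>{1..m}. real (num_displaced Early m (hs @ [h]) k)) =
    real m * num_displaced Early m hs k - real k * num_displaced Early m hs k
    + (if k = 0 then real (m - length hs)
       else of_bool (k = 1) * real (length hs) + real (k - 1) * num_displaced Early m hs (k - 1))"
proof -
  let ?d = "\<lambda>hs i. displacement Early m hs i"
  obtain L where L: "chain_table m hs (final_table Early m hs) L" using chain_table_exists[OF hs(1)] hs(2) by auto
  note occ = chain_tableD(3)[OF L] and dist = chain_tableD(1)[OF L]
  have new: "?d (hs @ [h]) (length hs) = of_bool (h \<in> set (concat L))" if h: "h \<in> {1..m}" for h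
  proof (cases "content (final_table Early m hs) h")
    case None
    then show ?thesis using chain_table_step_empty(2)[OF L None h] unfolding occ by simp
  next
    case (Some i')
    then have h': "h \<in> set (concat L)" unfolding occ by simp
    then obtain xs where xs: "xs \<in> set L" "h \<in> set xs" by auto
    then obtain A B where AB: "L = A @ xs # B" by (meson split_list)
    obtain u v p where p: "xs = u @ v" "p < length u" "u ! p = h" "last u = h" "?d (hs @ [h]) (length hs) = length u - p"
      using chain_table_step_occupied[OF L[unfolded AB] xs(2) hs(2)] by metis
    have "distinct u" using dist xs(1) p(1) by (auto simp: distinct_concat_iff)
    \<comment> \<open>The early policy cuts directly after \<open>h\<close>. As the cells are
      distinct, \<open>h\<close> has position \<open>length u - 1\<close>, so the new item gets
      displacement 1.\<close>
    moreover have "u ! (length u - 1) = h" using p by (metis last_conv_nth length_greater_0_conv less_zeroE list.size(3))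
    ultimately have "p = length u - 1" using p by (metis diff_less length_greater_0_conv less_nat_zero_code less_one list.size(3) nth_eq_iff_index_eq)
    then show ?thesis using p h' by simp
  qed
  have "\<exists>S\<subseteq>{1..m}. card S = ?d hs i \<and> (\<forall>h\<in>{1..m}. ?d (hs @ [h]) i = ?d hs i + of_bool (h \<in> S))"
    if i: "i < length hs" for i
  proof -
    obtain xs p q where loc: "located hs (final_table Early m hs) L i xs p q" using chain_tableD(8)[OF L i] by blast
    note pq = locatedD(1-3)[OF loc]
    have dxs: "distinct xs" using dist pq(1) by (auto simp: distinct_concat_iff)
    \<comment> \<open>The cells of the path to the item; hitting one of them pushes the item one cell further.\<close>
    define S where "S = (!) xs ` {p..<q}"
    have Sxs: "S \<subseteq> set xs" using pq by (auto simp: S_def)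
    have Sm: "S \<subseteq> {1..m}" using Sxs pq(1) chain_tableD(4)[OF L] by fastforce
    have disp: "?d hs i = q - p" by (rule displacement_located[OF L loc])
    have cardS: "card S = q - p" unfolding S_def using dxs pq(3)
      by (subst card_image) (auto intro!: inj_onI simp: nth_eq_iff_index_eq)
    have "?d (hs @ [h]) i = ?d hs i + of_bool (h \<in> S)" if h: "h \<in> {1..m}" for h
    proof (cases "content (final_table Early m hs) h")
      case None
      then have "h \<notin> set (concat L)" unfolding occ by simp
      then have "h \<notin> S" using Sxs pq(1) by auto
      then show ?thesis using chain_table_step_empty(3)[OF L None h i] by simp
    next
      case (Some i')
      then have "h \<in> set (concat L)" unfolding occ by simp
      then obtain ys where ys: "ys \<in> set L" "h \<in> set ys" by auto
      then obtain A B where AB: "L = A @ ys # B" by (meson split_list)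
      obtain u v where uv: "ys = u @ v" "h \<in> set u" "last u = h"
        and d: "?d (hs @ [h]) i = q - p + of_bool (xs = ys \<and> p < length u \<and> length u \<le> q)"
        using chain_table_step_occupied[OF L[unfolded AB] ys(2) hs(2)] loc[unfolded AB] i by metis
      \<comment> \<open>The cut lies directly after position \<open>length u - 1\<close>, that of
        \<open>h\<close>, so it separates the item from the start of its search exactly when this
        position is in \<open>{p..<q}\<close>.\<close>
      have "h \<in> S \<longleftrightarrow> xs = ys \<and> p < length u \<and> length u \<le> q"
      proof (cases "xs = ys")
        case False
        then have "set xs \<inter> set ys = {}" using dist ys(1) pq(1) by (auto simp: distinct_concat_iff)
        then show ?thesis using False Sxs ys(2) by auto
      next
        case True
        have "u \<noteq> []" using uv by auto
        then have 1: "xs ! (length u - 1) = h" "length u - 1 < length xs"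
          using uv True by (auto simp: nth_append last_conv_nth less_Suc_eq_le diff_le_self trans_less_add1)
        have "h \<in> S \<longleftrightarrow> length u - 1 \<in> {p..<q}"
        proof
          assume "h \<in> S"
          then obtain r where "r \<in> {p..<q}" "xs ! r = xs ! (length u - 1)" using 1 by (auto simp: S_def)
          then show "length u - 1 \<in> {p..<q}" using dxs pq(3) 1 nth_eq_iff_index_eq[of xs r "length u - 1"] by auto
        next
          assume "length u - 1 \<in> {p..<q}"
          then show "h \<in> S" using 1 by (auto simp: S_def)
        qed
        then show ?thesis using True \<open>u \<noteq> []\<close> by (cases u) auto
      qed
      then show ?thesis using d disp by simp
    qed
    then show ?thesis using Sm cardS disp by auto
  qed
  then obtain S where S: "\<And>i. i < length hs \<Longrightarrow> S i \<subseteq> {1..m}" "\<And>i. i < length hs \<Longrightarrow> card (S i) = ?d hs i"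
    "\<And>i h. i < length hs \<Longrightarrow> h \<in> {1..m} \<Longrightarrow> ?d (hs @ [h]) i = ?d hs i + of_bool (h \<in> S i)" by metis
  \<comment> \<open>Of the \<open>m\<close> addresses, \<open>?d hs i\<close> push the item one cell
    further and the others leave it. Where an indicator is nonzero, the factor
    \<open>?d hs i\<close> equals the constant \<open>k\<close> or \<open>k - 1\<close>.\<close>
  have old: "(\<Sum>h\<in>{1..m}. of_bool (?d (hs @ [h]) i = k)) =
    real m * of_bool (?d hs i = k) - real k * of_bool (?d hs i = k) + real (k - 1) * of_bool (Suc (?d hs i) = k)"
    if i: "i < length hs" for i
  proof -
    have fin: "finite (S i)" using S(1)[OF i] finite_subset by blast
    have "card (S i) \<le> card {1..m}" by (intro card_mono S(1) i) simp
    then have le: "?d hs i \<le> m" using S(2)[OF i] by simp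
    have "(\<Sum>h\<in>{1..m}. of_bool (?d (hs @ [h]) i = k) :: real) =
      (\<Sum>h\<in>{1..m} - S i. of_bool (?d (hs @ [h]) i = k)) + (\<Sum>h\<in>S i. of_bool (?d (hs @ [h]) i = k))"
      using S(1)[OF i] by (intro sum.subset_diff) auto
    also have "\<dots> = (\<Sum>h\<in>{1..m} - S i. of_bool (?d hs i = k)) + (\<Sum>h\<in>S i. of_bool (Suc (?d hs i) = k))"
      using S(1,3)[OF i] by (intro arg_cong2[where f = "(+)"] sum.cong refl) auto
    also have "\<dots> = (real m - ?d hs i) * of_bool (?d hs i = k) + ?d hs i * of_bool (Suc (?d hs i) = k)"
      using S(2)[OF i] card_Diff_subset[OF fin S(1)[OF i]] le by (simp add: of_nat_diff)
    also have "\<dots> = real m * of_bool (?d hs i = k) - real k * of_bool (?d hs i = k)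
        + real (k - 1) * of_bool (Suc (?d hs i) = k)"
      by (auto simp: algebra_simps)
    finally show ?thesis .
  qed
  have "(\<Sum>h\<in>{1..m}. real (num_displaced Early m (hs @ [h]) k)) =
    (\<Sum>h\<in>{1..m}. \<Sum>i<length hs. of_bool (?d (hs @ [h]) i = k)) + (\<Sum>h\<in>{1..m}. of_bool (of_bool (h \<in> set (concat L)) = k))"
    unfolding num_displaced_sum using new by (simp add: sum.distrib)
  also have "(\<Sum>h\<in>{1..m}. \<Sum>i<length hs. of_bool (?d (hs @ [h]) i = k) :: real) =
    (\<Sum>i<length hs. real m * of_bool (?d hs i = k) - real k * of_bool (?d hs i = k) + real (k - 1) * of_bool (Suc (?d hs i) = k))"
    by (subst sum.swap) (intro sum.cong refl old, simp)
  also have "\<dots> = real m * num_displaced Early m hs k - real k * num_displaced Early m hs k +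
     real (k - 1) * (\<Sum>i<length hs. of_bool (Suc (?d hs i) = k))"
    unfolding num_displaced_sum sum.distrib sum_subtractf sum_distrib_left by (rule refl)
  \<comment> \<open>For \<open>k = 0\<close> truncated subtraction makes the factor
    \<open>k - 1\<close> zero on both sides; otherwise \<open>Suc d = k\<close> means
    \<open>d = k - 1\<close>.\<close>
  also have "real (k - 1) * (\<Sum>i<length hs. of_bool (Suc (?d hs i) = k)) = real (k - 1) * num_displaced Early m hs (k - 1)"
    unfolding num_displaced_sum by (cases k) auto
  also have "(\<Sum>h\<in>{1..m}. of_bool (of_bool (h \<in> set (concat L)) = k)) =
    (if k = 0 then real (m - length hs) else of_bool (k = 1) * real (length hs))"
  proof -
    have c: "card (set (concat L)) = length hs" using distinct_card[OF dist] chain_tableD(2)[OF L] by simp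
    have "(\<Sum>h\<in>{1..m}. of_bool (of_bool (h \<in> set (concat L)) = k)) =
      (\<Sum>h\<in>{1..m} - set (concat L). of_bool (of_bool (h \<in> set (concat L)) = k)) +
      (\<Sum>h\<in>set (concat L). of_bool (of_bool (h \<in> set (concat L)) = k))"
      using chain_tableD(4)[OF L] by (intro sum.subset_diff) auto
    also have "\<dots> = (\<Sum>h\<in>{1..m} - set (concat L). of_bool (0 = k)) + (\<Sum>h\<in>set (concat L). of_bool (1 = k))"
      by (intro arg_cong2[where f = "(+)"] sum.cong refl) auto
    also have "\<dots> = real (m - length hs) * of_bool (0 = k) + real (length hs) * of_bool (1 = k)"
      unfolding sum_constant c using card_Diff_subset[OF List.finite_set chain_tableD(4)[OF L]] c by simp
    finally show ?thesis by auto
  qed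
  finally show ?thesis by simp
qed

section \<open>Recurrences for the expected counts\<close>

lemma set_random_hashes:
  "0 < m \<Longrightarrow> set_pmf (random_hashes m n) = {hs. set hs \<subseteq> {1..m} \<and> length hs = n}"
  by (auto simp: random_hashes_def set_replicate_pmf in_lists_conv_set)

lemma finite_random_hashes: "0 < m \<Longrightarrow> finite (set_pmf (random_hashes m n))"
  by (simp add: set_random_hashes finite_lists_length_eq)

text \<open>Conditioning on the first \<open>n\<close> addresses: the last one is independent of
  them, uniform, and appended at the end, as in \<open>final_table_snoc\<close>. This turns the
  one-step sums into recurrences for the means.\<close>

lemma expectation_random_hashes_Suc:
  fixes f :: "nat list \<Rightarrow> real"
  assumes m: "0 < m"
  shows "measure_pmf.expectation (random_hashes m (Suc n)) f =
    measure_pmf.expectation (random_hashes m n) (\<lambda>hs. (\<Sum>h\<in>{1..m}. f (hs @ [h])) / m)"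
proof -
  let ?H = "random_hashes m n"
  have "random_hashes m (Suc n) = ?H \<bind> (\<lambda>hs. map_pmf (\<lambda>h. hs @ [h]) (pmf_of_set {1..m}))"
    using replicate_pmf_distrib[of n 1 "pmf_of_set {1..m}"]
    by (simp add: random_hashes_def replicate_pmf_1 map_pmf_def bind_assoc_pmf bind_return_pmf)
  then have "measure_pmf.expectation (random_hashes m (Suc n)) f =
      (\<Sum>hs\<in>set_pmf ?H. pmf ?H hs *\<^sub>R measure_pmf.expectation (map_pmf (\<lambda>h. hs @ [h]) (pmf_of_set {1..m})) f)"
    using m by (simp only:) (intro pmf_expectation_bind, auto simp: finite_random_hashes)
  also have "\<dots> = (\<Sum>hs\<in>set_pmf ?H. pmf ?H hs *\<^sub>R ((\<Sum>h\<in>{1..m}. f (hs @ [h])) / m))"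
    using m by (simp add: integral_pmf_of_set)
  also have "\<dots> = measure_pmf.expectation ?H (\<lambda>hs. (\<Sum>h\<in>{1..m}. f (hs @ [h])) / m)"
    using m by (intro integral_measure_pmf[symmetric]) (auto simp: finite_random_hashes)
  finally show ?thesis .
qed

lemma integrable_random_hashes [intro, simp]:
  fixes f :: "nat list \<Rightarrow> real"
  shows "0 < m \<Longrightarrow> integrable (measure_pmf (random_hashes m n)) f"
  by (intro integrable_measure_pmf_finite finite_random_hashes)

lemma expectation_random_hashes_cong:
  fixes f :: "nat list \<Rightarrow> real"
  assumes "0 < m" "\<And>hs. set hs \<subseteq> {1..m} \<Longrightarrow> length hs = n \<Longrightarrow> f hs = g hs"
  shows "measure_pmf.expectation (random_hashes m n) f = measure_pmf.expectation (random_hashes m n) g"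
  by (intro integral_cong_AE) (auto simp: AE_measure_pmf_iff set_random_hashes assms)

section \<open>The expected counts and their recurrences\<close>

definition mean_unsuccessful :: "policy \<Rightarrow> nat \<Rightarrow> nat \<Rightarrow> nat \<Rightarrow> real" where
  "mean_unsuccessful P m n k =
     measure_pmf.expectation (random_hashes m n) (\<lambda>hs. real (num_unsuccessful P m hs k))"

definition mean_displaced :: "policy \<Rightarrow> nat \<Rightarrow> nat \<Rightarrow> nat \<Rightarrow> real" where
  "mean_displaced P m n k =
     measure_pmf.expectation (random_hashes m n) (\<lambda>hs. real (num_displaced P m hs k))"

lemma random_hashes_0: "random_hashes m 0 = return_pmf []"
  by (simp add: random_hashes_def)

lemma mean_unsuccessful_init: "0 < k \<Longrightarrow> mean_unsuccessful P m 0 k = 0"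
  by (simp add: mean_unsuccessful_def random_hashes_0 num_unsuccessful_def unsuccessful_def
      final_table_def empty_table_def)

lemma mean_displaced_init: "mean_displaced P m 0 k = 0"
  by (simp add: mean_displaced_def random_hashes_0 num_displaced_def)

lemma mean_unsuccessful_nonneg: "mean_unsuccessful P m n k \<ge> 0"
  by (simp add: mean_unsuccessful_def)

lemma mean_displaced_nonneg: "mean_displaced P m n k \<ge> 0"
  by (simp add: mean_displaced_def)

lemma mean_unsuccessful_0:
  assumes "0 < m" "n \<le> m"
  shows "mean_unsuccessful P m n 0 = real m - real n"
proof -
  have "num_unsuccessful P m hs 0 = m - n" if "set hs \<subseteq> {1..m}" "length hs = n" for hs
    using chain_table_exists[OF that(1)] num_unsuccessful_0 that(2) assms(2) by metis
  then have "mean_unsuccessful P m n 0 = measure_pmf.expectation (random_hashes m n) (\<lambda>_. real (m - n))"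
    unfolding mean_unsuccessful_def by (intro expectation_random_hashes_cong assms(1)) simp
  then show ?thesis using assms(2) by (simp add: of_nat_diff)
qed

lemma mean_unsuccessful_Suc:
  assumes m: "n < m" and k: "0 < k"
  shows "mean_unsuccessful P m (Suc n) k = mean_unsuccessful P m n k
    + (of_bool (k = 1) * (real m - real n)
       + real (k - 1) * (mean_unsuccessful P m n (k - 1) - mean_unsuccessful P m n k)) / m"
proof -
  have m0: "0 < m" using m by simp
  let ?f = "\<lambda>k hs. real (num_unsuccessful P m hs k)"
  have "mean_unsuccessful P m (Suc n) k = measure_pmf.expectation (random_hashes m n)
    (\<lambda>hs. ?f k hs + (of_bool (k = 1) * (real m - real n) + real (k - 1) * (?f (k - 1) hs - ?f k hs)) / m)"
    unfolding mean_unsuccessful_def expectation_random_hashes_Suc[OF m0]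
  proof (rule expectation_random_hashes_cong[OF m0])
    fix hs assume "set hs \<subseteq> {1..m}" "length hs = n"
    then show "(\<Sum>h = 1..m. ?f k (hs @ [h])) / real m =
      ?f k hs + (of_bool (k = 1) * (real m - real n) + real (k - 1) * (?f (k - 1) hs - ?f k hs)) / real m"
      using sum_num_unsuccessful_snoc[of hs m k P] m k m0 by (simp add: add_divide_distrib of_nat_diff)
  qed
  then show ?thesis unfolding mean_unsuccessful_def using m0 by simp
qed

lemma mean_displaced_Late_Suc:
  assumes m: "n < m"
  shows "mean_displaced Late m (Suc n) k = mean_displaced Late m n k + mean_unsuccessful Late m n k / m"
proof -
  have m0: "0 < m" using m by simp
  have "mean_displaced Late m (Suc n) k = measure_pmf.expectation (random_hashes m n)
    (\<lambda>hs. real (num_displaced Late m hs k) + real (num_unsuccessful Late m hs k) / m)"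
    unfolding mean_displaced_def expectation_random_hashes_Suc[OF m0]
    using sum_num_displaced_Late_snoc m m0
    by (intro expectation_random_hashes_cong[OF m0]) (simp add: add_divide_distrib)
  then show ?thesis unfolding mean_displaced_def mean_unsuccessful_def using m0 by simp
qed

lemma mean_displaced_Early_Suc:
  assumes m: "n < m"
  shows "mean_displaced Early m (Suc n) k = mean_displaced Early m n k
    + ((if k = 0 then real m - real n
        else of_bool (k = 1) * real n + real (k - 1) * mean_displaced Early m n (k - 1))
       - real k * mean_displaced Early m n k) / m"
proof -
  have m0: "0 < m" using m by simp
  let ?f = "\<lambda>k hs. real (num_displaced Early m hs k)"
  have "mean_displaced Early m (Suc n) k = measure_pmf.expectation (random_hashes m n)
    (\<lambda>hs. ?f k hs + ((if k = 0 then real m - real n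
        else of_bool (k = 1) * real n + real (k - 1) * ?f (k - 1) hs) - real k * ?f k hs) / m)"
    unfolding mean_displaced_def expectation_random_hashes_Suc[OF m0]
  proof (rule expectation_random_hashes_cong[OF m0])
    fix hs assume "set hs \<subseteq> {1..m}" "length hs = n"
    then show "(\<Sum>h = 1..m. ?f k (hs @ [h])) / real m = ?f k hs + ((if k = 0 then real m - real n
        else of_bool (k = 1) * real n + real (k - 1) * ?f (k - 1) hs) - real k * ?f k hs) / real m"
      using sum_num_displaced_Early_snoc[of hs m k] m m0 by (simp add: add_divide_distrib diff_divide_distrib of_nat_diff)
  qed
  then show ?thesis unfolding mean_displaced_def using m0 by (cases "k = 0") simp_all
qed

section \<open>Search probabilities as normalized expected counts\<close>

lemma pmf_random_displacement:
  assumes "0 < m" "0 < n"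
  shows "pmf (random_displacement P m n) k = 1 / real n * mean_displaced P m n k"
proof -
  have "pmf (random_displacement P m n) k = measure_pmf.expectation (random_hashes m n)
     (\<lambda>hs. pmf (map_pmf (displacement P m hs) (pmf_of_set {..<n})) k)"
    by (simp add: random_displacement_def pair_pmf_def map_bind_pmf pmf_bind map_pmf_def bind_assoc_pmf bind_return_pmf)
  also have "\<dots> = measure_pmf.expectation (random_hashes m n) (\<lambda>hs. 1 / real n * real (num_displaced P m hs k))"
  proof (intro expectation_random_hashes_cong assms(1))
    fix hs :: "nat list" assume "length hs = n"
    then have "{..<n} \<inter> displacement P m hs -` {k} = {i \<in> {..<length hs}. displacement P m hs i = k}" by auto
    then show "pmf (map_pmf (displacement P m hs) (pmf_of_set {..<n})) k = 1 / real n * real (num_displaced P m hs k)"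
      using assms(2) by (simp add: pmf_map measure_pmf_of_set num_displaced_def lessThan_empty_iff)
  qed
  finally show ?thesis by (simp add: mean_displaced_def)
qed

lemma pmf_random_unsuccessful:
  assumes "0 < m"
  shows "pmf (random_unsuccessful P m n) k = 1 / real m * mean_unsuccessful P m n k"
proof -
  have "pmf (random_unsuccessful P m n) k = measure_pmf.expectation (random_hashes m n)
     (\<lambda>hs. pmf (map_pmf (unsuccessful P m hs) (pmf_of_set {1..m})) k)"
    by (simp add: random_unsuccessful_def pair_pmf_def map_bind_pmf pmf_bind map_pmf_def bind_assoc_pmf bind_return_pmf)
  also have "\<dots> = measure_pmf.expectation (random_hashes m n) (\<lambda>hs. 1 / real m * real (num_unsuccessful P m hs k))"
  proof (intro expectation_random_hashes_cong assms(1))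
    fix hs :: "nat list"
    have "{1..m} \<inter> unsuccessful P m hs -` {k} = {j \<in> {1..m}. unsuccessful P m hs j = k}" by auto
    then show "pmf (map_pmf (unsuccessful P m hs) (pmf_of_set {1..m})) k = 1 / real m * real (num_unsuccessful P m hs k)"
      using assms by (simp add: pmf_map measure_pmf_of_set num_unsuccessful_def)
  qed
  finally show ?thesis by (simp add: mean_unsuccessful_def)
qed

section \<open>Euler schemes for Yule-type equations\<close>

text \<open>Each of the \<open>i\<close> increments \<open>d\<close> is amplified by at most
  \<open>(1 + q / m) ^ i\<close>, which stays below \<open>exp q\<close> as
  \<open>i \<le> m\<close>. It serves both for the errors of the Euler schemes and for the growth of
  weighted sums.\<close>

lemma gronwall_discrete:
  fixes e :: "nat \<Rightarrow> real" and m i :: nat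
  assumes "e 0 \<le> 0" "\<And>i. i < m \<Longrightarrow> e (Suc i) \<le> (1 + q / m) * e i + d"
    and "0 \<le> q" "0 \<le> d" and i: "i \<le> m"
  shows "e i \<le> real i * d * exp q"
proof (cases "m = 0")
  case True
  then show ?thesis using assms by simp
next
  case False
  have *: "e j \<le> real j * d * (1 + q / m) ^ j" if "j \<le> m" for j
    using that
  proof (induction j)
    case 0
    then show ?case using assms(1) by simp
  next
    case (Suc j)
    have "e (Suc j) \<le> (1 + q / m) * e j + d" using Suc.prems by (intro assms(2)) simp
    also have "\<dots> \<le> (1 + q / m) * (real j * d * (1 + q / m) ^ j) + d * (1 + q / m) ^ Suc j"
    proof (intro add_mono mult_left_mono)
      have "1 \<le> (1 + q / m) ^ Suc j" using assms(3) by (intro one_le_power) simp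
      then show "d \<le> d * (1 + q / m) ^ Suc j" using mult_left_mono[OF _ assms(4), of 1] by simp
    qed (use Suc assms in auto)
    also have "\<dots> = real (Suc j) * d * (1 + q / m) ^ Suc j" by (simp add: algebra_simps add_divide_distrib)
    finally show ?case .
  qed
  have "(1 + q / m) ^ i \<le> exp (q / m) ^ i" using assms(3) by (intro power_mono) auto
  also have "\<dots> = exp (real i * (q / m))" by (rule exp_of_nat_mult[symmetric])
  also have "\<dots> \<le> exp (real m * (q / m))"
    using i assms(3) by (subst exp_le_cancel_iff) (intro mult_right_mono, auto)
  also have "\<dots> = exp q" using False by simp
  finally show ?thesis using *[OF i] assms(4) by (meson mult_left_mono order_trans mult_nonneg_nonneg of_nat_0_le_iff)
qed

lemma C1_imp_lipschitz:
  fixes F \<phi> :: "real \<Rightarrow> real"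
  assumes deriv: "\<And>x. x \<in> {0..1} \<Longrightarrow> (F has_real_derivative \<phi> x) (at x within {0..1})"
    and cont: "continuous_on {0..1} \<phi>"
  shows "\<exists>B. B-lipschitz_on {0..1} F"
proof -
  have "bounded (\<phi> ` {0..1})" using cont by (intro compact_imp_bounded compact_continuous_image) auto
  then obtain B where B: "0 < B" "\<And>x. x \<in> {0..1} \<Longrightarrow> \<bar>\<phi> x\<bar> \<le> B" by (auto simp: bounded_pos)
  have "B-lipschitz_on {0..1} F"
  proof (rule bounded_derivative_imp_lipschitz)
    show "(F has_derivative (*) (\<phi> x)) (at x within {0..1})" if "x \<in> {0..1}" for x
      using deriv[OF that] by (simp add: has_field_derivative_def)
    show "onorm ((*) (\<phi> x)) \<le> B" if "x \<in> {0..1}" for x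
      using B(2)[OF that] by (intro onorm_le) (auto simp: abs_mult intro: mult_right_mono)
  qed (use B in auto)
  then show ?thesis ..
qed

text \<open>Here \<open>\<phi>\<close> is the slope along the exact solution \<open>F\<close>; the
  dependence of the scheme on its own state enters only through the error term with factor
  \<open>c\<close>. The scaled local errors are of order 1 / m^2, and Gronwall's inequality over at
  most \<open>m\<close> steps leaves an error of order 1 / m.\<close>

lemma euler_scheme:
  fixes a :: "nat \<Rightarrow> nat \<Rightarrow> real" and F \<phi> :: "real \<Rightarrow> real"
  assumes deriv: "\<And>x. x \<in> {0..1} \<Longrightarrow> (F has_real_derivative \<phi> x) (at x within {0..1})"
    and lip: "B-lipschitz_on {0..1} \<phi>"
    and init: "F 0 = 0" "\<And>m. a m 0 = 0"
    and step: "\<And>m i. i < m \<Longrightarrow>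
      \<bar>a m (Suc i) - a m i - \<phi> (i / m)\<bar> \<le> c * \<bar>a m i / m - F (i / m)\<bar> + D / m"
    and nonneg: "0 \<le> c" "0 \<le> D"
  shows "\<exists>C. \<forall>m i. 0 < m \<longrightarrow> i \<le> m \<longrightarrow> \<bar>a m i / m - F (i / m)\<bar> \<le> C / m"
proof (intro exI allI impI)
  fix m i :: nat assume m: "0 < m" and i: "i \<le> m"
  have B: "0 \<le> B" using lip by (rule lipschitz_on_nonneg)
  let ?e = "\<lambda>i. \<bar>a m i / m - F (i / m)\<bar>"
  have "?e i \<le> real i * ((B + D) / m\<^sup>2) * exp c"
  proof (rule gronwall_discrete[OF _ _ nonneg(1) _ i])
    fix i assume i: "i < m"
    let ?x = "real i / m" let ?y = "real (Suc i) / m"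
    have xy: "0 \<le> ?x" "?x < ?y" "?y \<le> 1" using i m by (auto simp: divide_simps)
    \<comment> \<open>The exact increment has slope \<open>\<phi> z\<close> at an intermediate
      point, which is within \<open>B / m\<close> of \<open>\<phi> ?x\<close> by the Lipschitz
      bound.\<close>
    have "\<exists>z\<in>{?x<..<?y}. F ?y - F ?x = \<phi> z * (?y - ?x)"
    proof (rule mvt_simple[OF xy(2)])
      fix z assume z: "?x \<le> z" "z \<le> ?y"
      have "z \<in> {0..1}" using order_trans[OF xy(1) z(1)] order_trans[OF z(2) xy(3)] by simp
      moreover have "{?x..?y} \<subseteq> {0..1}" using xy by (auto simp del: of_nat_Suc)
      ultimately have "(F has_real_derivative \<phi> z) (at z within {?x..?y})"
        by (intro DERIV_subset[OF deriv])
      then show "(F has_derivative (*) (\<phi> z)) (at z within {?x..?y})" by (simp add: has_field_derivative_def)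
    qed
    then obtain z where z: "?x < z" "z < ?y" "F ?y - F ?x = \<phi> z * (?y - ?x)" by auto
    have h: "?y - ?x = 1 / m" by (simp add: diff_divide_distrib[symmetric])
    have "\<bar>\<phi> z - \<phi> ?x\<bar> \<le> B * \<bar>z - ?x\<bar>"
      using lipschitz_onD[OF lip, of z ?x] z xy by (simp add: dist_real_def)
    also have "\<dots> \<le> B * (1 / m)" using z h B by (intro mult_left_mono) auto
    finally have 1: "\<bar>\<phi> z - \<phi> ?x\<bar> \<le> B / m" by simp
    have "a m (Suc i) / m - F ?y = (a m i / m - F ?x) + (a m (Suc i) - a m i - \<phi> ?x) / m - (\<phi> z - \<phi> ?x) / m"
      using z(3) unfolding h by (simp add: diff_divide_distrib)
    moreover have "\<bar>x + y / m - z / m\<bar> \<le> \<bar>x\<bar> + \<bar>y\<bar> / m + \<bar>z\<bar> / m" for x y z :: real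
    proof -
      have "\<bar>x + y / m - z / m\<bar> \<le> \<bar>x\<bar> + \<bar>y / m\<bar> + \<bar>z / m\<bar>" by arith
      then show ?thesis by (simp add: abs_divide)
    qed
    ultimately have "?e (Suc i) \<le> ?e i + \<bar>a m (Suc i) - a m i - \<phi> ?x\<bar> / m + \<bar>\<phi> z - \<phi> ?x\<bar> / m"
      by metis
    also have "\<dots> \<le> ?e i + (c * ?e i + D / m) / m + (B / m) / m"
      using step[OF i] 1 by (intro add_mono divide_right_mono) auto
    also have "\<dots> = (1 + c / m) * ?e i + (B + D) / m\<^sup>2"
      by (simp add: algebra_simps add_divide_distrib power2_eq_square)
    finally show "?e (Suc i) \<le> (1 + c / m) * ?e i + (B + D) / m\<^sup>2" .
  qed (use init B nonneg in auto)
  also have "\<dots> \<le> real m * ((B + D) / m\<^sup>2) * exp c"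
    using i B nonneg by (intro mult_right_mono) auto
  also have "\<dots> = ((B + D) * exp c) / m" using m by (simp add: power2_eq_square)
  finally show "?e i \<le> ((B + D) * exp c) / m" .
qed

text \<open>The error bound is uniform in \<open>i\<close>, so it may be taken at the moving point
  \<open>n N / m N\<close>; continuity of \<open>F\<close> then leads to
  \<open>\<alpha>\<close>.\<close>

lemma euler_scheme_tendsto:
  fixes F \<phi> :: "real \<Rightarrow> real"
  assumes C: "\<And>m i. 0 < m \<Longrightarrow> i \<le> m \<Longrightarrow> \<bar>a m i / real m - F (real i / real m)\<bar> \<le> C / real m"
    and cont: "continuous_on {0..1} F"
    and m: "filterlim m at_top sequentially" and nm: "\<And>N. n N \<le> m N" "\<And>N. 0 < m N"
    and \<alpha>: "(\<lambda>N. real (n N) / real (m N)) \<longlonglongrightarrow> \<alpha>"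
  shows "(\<lambda>N. a (m N) (n N) / real (m N)) \<longlonglongrightarrow> F \<alpha>"
proof -
  have r: "real (n N) / real (m N) \<in> {0..1}" for N using nm[of N] by (auto simp: divide_simps)
  then have "\<alpha> \<in> {0..1}" using closed_sequentially[OF _ _ \<alpha>] by blast
  then have "(\<lambda>N. F (real (n N) / real (m N))) \<longlonglongrightarrow> F \<alpha>"
    using continuous_on_tendsto_compose[OF cont \<alpha>] r by auto
  moreover have "(\<lambda>N. a (m N) (n N) / real (m N) - F (real (n N) / real (m N))) \<longlonglongrightarrow> 0"
  proof (rule Lim_null_comparison)
    show "(\<lambda>N. C / real (m N)) \<longlonglongrightarrow> 0"
      using filterlim_compose[OF filterlim_real_sequentially m] by (intro tendsto_divide_0[OF tendsto_const] filterlim_at_top_imp_at_infinity)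
  qed (use C nm in auto)
  ultimately show ?thesis using tendsto_add by fastforce
qed

text \<open>
  Convolution with a quadratic polynomial: expanding the polynomial separates \<open>x\<close> from \<open>t\<close>, so no
  differentiation under the integral is needed.
\<close>

definition conv :: "real \<Rightarrow> real \<Rightarrow> real \<Rightarrow> (real \<Rightarrow> real) \<Rightarrow> real \<Rightarrow> real" where
  "conv a b c K x = integral {0..x} (\<lambda>t. (a + b * (x - t) + c * (x - t)\<^sup>2) * K t)"

section \<open>Convolutions with Yule kernels as exact solutions\<close>

lemma conv_0: "conv a b c K 0 = 0"
  by (simp add: conv_def)

lemma conv_has_real_derivative:
  assumes K: "continuous_on {0..1} K" and x: "x \<in> {0..1}"
  shows "(conv a b c K has_real_derivative a * K x + conv b (2 * c) 0 K x) (at x within {0..1})"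
proof -
  define A where "A i y = integral {0..y} (\<lambda>t. t ^ i * K t)" for i :: nat and y
  have int: "(\<lambda>t. t ^ i * K t) integrable_on {0..y}" if "y \<in> {0..1}" for i :: nat and y
    using that by (intro integrable_continuous_real continuous_intros continuous_on_subset[OF K]) auto
  have exp: "conv a b c K y = (a + b * y + c * y\<^sup>2) * A 0 y - (b + 2 * c * y) * A 1 y + c * A 2 y"
    if "y \<in> {0..1}" for a b c y
  proof -
    have "conv a b c K y = integral {0..y} (\<lambda>t. (a + b * y + c * y\<^sup>2) * (t ^ 0 * K t)
        - (b + 2 * c * y) * (t ^ 1 * K t) + c * (t ^ 2 * K t))"
      unfolding conv_def by (intro integral_cong) (simp add: power2_eq_square algebra_simps)
    also have "\<dots> = (a + b * y + c * y\<^sup>2) * A 0 y - (b + 2 * c * y) * A 1 y + c * A 2 y"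
      unfolding A_def integral_mult_right[symmetric]
      by (subst integral_add integral_diff; (intro integrable_add integrable_diff integrable_on_mult_right int that)?)+ simp
    finally show ?thesis .
  qed
  have dA [derivative_intros]: "(A i has_real_derivative x ^ i * K x) (at x within {0..1})" for i
    unfolding A_def using x by (intro integral_has_real_derivative continuous_intros K)
  have "((\<lambda>y. (a + b * y + c * y\<^sup>2) * A 0 y - (b + 2 * c * y) * A 1 y + c * A 2 y) has_real_derivative
    a * K x + ((b + 2 * c * x) * A 0 x - 2 * c * A 1 x)) (at x within {0..1})"
    by (auto intro!: derivative_eq_intros simp: power2_eq_square algebra_simps)
  then have "((\<lambda>y. (a + b * y + c * y\<^sup>2) * A 0 y - (b + 2 * c * y) * A 1 y + c * A 2 y) has_real_derivative
    a * K x + conv b (2 * c) 0 K x) (at x within {0..1})"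
    using x by (simp add: exp)
  then show ?thesis unfolding has_field_derivative_def
    by (rule has_derivative_transform[OF x, rotated]) (simp add: exp)
qed

text \<open>
  For \<open>\<delta> = 1\<close> this is the probability that a Yule process started from 1 has size \<open>k\<close> at time \<open>t\<close>,
  for \<open>\<delta> = 0\<close> the probability that its size is at least \<open>k\<close>.
\<close>

definition yule :: "real \<Rightarrow> nat \<Rightarrow> real \<Rightarrow> real" where
  "yule \<delta> k t = exp (- \<delta> * t) * (1 - exp (- t)) ^ (k - 1)"

lemma continuous_on_yule: "continuous_on S (yule \<delta> k)"
  unfolding yule_def by (intro continuous_intros)

text \<open>The forward equation of the Yule process: writing the factor \<open>exp (- t)\<close> as
  \<open>1 - (1 - exp (- t))\<close> splits the derivative into the levels \<open>k - 1\<close> and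
  \<open>k\<close>. At \<open>k = 1\<close> the kernel is \<open>exp (- \<delta> * t)\<close> alone
  and the lower level has coefficient 0.\<close>

lemma yule_has_real_derivative:
  assumes "0 < k"
  shows "(yule \<delta> k has_real_derivative real (k - 1) * yule \<delta> (k - 1) t - (real (k - 1) + \<delta>) * yule \<delta> k t) (at t within S)"
proof (cases "k = 1")
  case True
  then show ?thesis unfolding yule_def by (auto intro!: derivative_eq_intros)
next
  case False
  then obtain j where j: "k = Suc (Suc j)" using assms by (metis One_nat_def gr0_implies_Suc not0_implies_Suc)
  have 1: "((\<lambda>t. (1 - exp (- t)) ^ Suc j) has_real_derivative (1 + real j) * (exp (- t) * (1 - exp (- t)) ^ j)) (at t within S)"
    by (intro DERIV_power_Suc) (auto intro!: derivative_eq_intros)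
  have 2: "((\<lambda>t. exp (- \<delta> * t)) has_real_derivative - \<delta> * exp (- \<delta> * t)) (at t within S)"
    by (auto intro!: derivative_eq_intros)
  show ?thesis unfolding yule_def j diff_Suc_1
    by (rule DERIV_cong[OF DERIV_mult[OF 2 1]]) (simp add: algebra_simps)
qed

text \<open>Duhamel's formula: mass that enters level 1 at rate \<open>a + b * x\<close> and then
  follows the Yule dynamics solves this linear system.\<close>

lemma conv_yule_has_real_derivative:
  assumes x: "x \<in> {0..1}" and k: "0 < k"
  shows "(conv a b 0 (yule \<delta> k) has_real_derivative of_bool (k = 1) * (a + b * x)
    + real (k - 1) * conv a b 0 (yule \<delta> (k - 1)) x - (real (k - 1) + \<delta>) * conv a b 0 (yule \<delta> k) x)
    (at x within {0..1})"
proof -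
  let ?g = "\<lambda>t. a + b * (x - t)"
  let ?K' = "\<lambda>t. real (k - 1) * yule \<delta> (k - 1) t - (real (k - 1) + \<delta>) * yule \<delta> k t"
  \<comment> \<open>Integration by parts against the kernel. The boundary value at
    \<open>t = 0\<close>, present only for \<open>k = 1\<close>, becomes the source
    \<open>a + b * x\<close>.\<close>
  have "((\<lambda>t. - (b * yule \<delta> k t) + ?g t * ?K' t) has_integral ?g x * yule \<delta> k x - ?g 0 * yule \<delta> k 0) {0..x}"
    using x by (intro fundamental_theorem_of_calculus)
      (auto intro!: derivative_eq_intros yule_has_real_derivative[OF k] simp: has_real_derivative_iff_has_vector_derivative[symmetric])
  then have "integral {0..x} (\<lambda>t. - (b * yule \<delta> k t) + ?g t * ?K' t) = a * yule \<delta> k x - (a + b * x) * yule \<delta> k 0"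
    by (simp add: integral_unique)
  moreover have "integral {0..x} (\<lambda>t. - (b * yule \<delta> k t) + ?g t * ?K' t) =
    integral {0..x} (\<lambda>t. - (b * yule \<delta> k t)
       + (real (k - 1) * (?g t * yule \<delta> (k - 1) t) - (real (k - 1) + \<delta>) * (?g t * yule \<delta> k t)))"
    by (simp add: algebra_simps)
  moreover have "\<dots> = - conv b 0 0 (yule \<delta> k) x + (real (k - 1) * conv a b 0 (yule \<delta> (k - 1)) x
       - (real (k - 1) + \<delta>) * conv a b 0 (yule \<delta> k) x)"
    unfolding conv_def integral_mult_right[symmetric] integral_neg[symmetric]
    by (subst integral_add integral_diff; (intro integrable_continuous_real continuous_intros continuous_on_yule)?)+ simp
  moreover have "yule \<delta> k 0 = of_bool (k = 1)" using k by (simp add: yule_def)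
  ultimately have "a * yule \<delta> k x + conv b (2 * 0) 0 (yule \<delta> k) x = of_bool (k = 1) * (a + b * x)
    + real (k - 1) * conv a b 0 (yule \<delta> (k - 1)) x - (real (k - 1) + \<delta>) * conv a b 0 (yule \<delta> k) x"
    by (simp add: algebra_simps)
  then show ?thesis using conv_has_real_derivative[OF continuous_on_yule x, of a b 0 \<delta> k] by metis
qed

section \<open>Convergence of the schemes to the convolutions\<close>

lemma lipschitz_conv:
  assumes K: "continuous_on {0..1} K"
  shows "\<exists>B. B-lipschitz_on {0..1} (conv a b c K)"
proof (rule C1_imp_lipschitz[OF conv_has_real_derivative[OF K]])
  have "continuous_on {0..1} (conv b (2 * c) 0 K)"
    by (intro DERIV_continuous_on[OF conv_has_real_derivative[OF K]])
  then show "continuous_on {0..1} (\<lambda>x. a * K x + conv b (2 * c) 0 K x)" using K by (intro continuous_intros)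
qed

lemma continuous_on_conv:
  assumes "continuous_on {0..1} K"
  shows "continuous_on {0..1} (conv a b c K)"
  using lipschitz_conv[OF assms] lipschitz_on_continuous_on by blast

text \<open>Induction on the level: the error at \<open>k - 1\<close> enters the scheme at
  \<open>k\<close> as a perturbation of order 1 / m, which \<open>euler_scheme\<close> tolerates. At
  \<open>k = 1\<close> its factor is 0, which starts the induction.\<close>

lemma yule_scheme:
  fixes w :: "nat \<Rightarrow> nat \<Rightarrow> nat \<Rightarrow> real"
  assumes init: "\<And>m k. 0 < k \<Longrightarrow> w m 0 k = 0"
    and step: "\<And>m i k. i < m \<Longrightarrow> 0 < k \<Longrightarrow> w m (Suc i) k = w m i k + of_bool (k = 1) * (a + b * (i / m))
      + (real (k - 1) * w m i (k - 1) - (real (k - 1) + \<delta>) * w m i k) / m"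
    and \<delta>: "0 \<le> \<delta>" and k: "0 < k"
  shows "\<exists>C. \<forall>m i. 0 < m \<longrightarrow> i \<le> m \<longrightarrow> \<bar>w m i k / m - conv a b 0 (yule \<delta> k) (i / m)\<bar> \<le> C / m"
  using k
proof (induction k rule: nat_less_induct)
  case (1 k)
  let ?F = "\<lambda>k. conv a b 0 (yule \<delta> k)"
  obtain C where C: "\<And>m i. 0 < m \<Longrightarrow> i \<le> m \<Longrightarrow> real (k - 1) * \<bar>w m i (k - 1) / m - ?F (k - 1) (i / m)\<bar> \<le> C / m"
    and C0: "0 \<le> C"
  proof (cases "k = 1")
    case True
    then show ?thesis using that[of 0] by simp
  next
    case False
    then obtain C where C: "\<forall>m i. 0 < m \<longrightarrow> i \<le> m \<longrightarrow> \<bar>w m i (k - 1) / m - ?F (k - 1) (i / m)\<bar> \<le> C / m"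
      using 1 by (metis One_nat_def diff_less less_one nat_neq_iff zero_less_diff)
    show ?thesis
    \<comment> \<open>The constant of the induction hypothesis carries no sign; its absolute value
      is passed on because \<open>euler_scheme\<close> asks for a nonnegative
      \<open>D\<close>.\<close>
    proof (rule that)
      fix m i :: nat assume "0 < m" "i \<le> m"
      then have "\<bar>w m i (k - 1) / m - ?F (k - 1) (i / m)\<bar> \<le> \<bar>C\<bar> / m"
        using C by (meson abs_ge_self divide_right_mono of_nat_0_le_iff order_trans)
      then show "real (k - 1) * \<bar>w m i (k - 1) / m - ?F (k - 1) (i / m)\<bar> \<le> real (k - 1) * \<bar>C\<bar> / m"
        by (metis mult_left_mono of_nat_0_le_iff times_divide_eq_right)
    qed simp
  qed
  obtain B1 B2 where B: "B1-lipschitz_on {0..1} (?F (k - 1))" "B2-lipschitz_on {0..1} (?F k)"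
    using lipschitz_conv[OF continuous_on_yule] by metis
  let ?\<phi> = "\<lambda>x. of_bool (k = 1) * (a + b * x) + real (k - 1) * ?F (k - 1) x - (real (k - 1) + \<delta>) * ?F k x"
  have 0: "\<exists>B. B-lipschitz_on {0..1} ?\<phi>"
  proof (rule C1_imp_lipschitz)
    let ?d = "\<lambda>k x. a * yule \<delta> k x + conv b (2 * 0) 0 (yule \<delta> k) x"
    show "(?\<phi> has_real_derivative of_bool (k = 1) * b + real (k - 1) * ?d (k - 1) x - (real (k - 1) + \<delta>) * ?d k x)
      (at x within {0..1})" if "x \<in> {0..1}" for x
      by (rule derivative_eq_intros conv_has_real_derivative[OF continuous_on_yule that] refl | simp)+
    show "continuous_on {0..1} (\<lambda>x. of_bool (k = 1) * b + real (k - 1) * ?d (k - 1) x - (real (k - 1) + \<delta>) * ?d k x)"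
      by (intro continuous_intros continuous_on_yule continuous_on_conv)
  qed
  then obtain B where lip: "B-lipschitz_on {0..1} ?\<phi>" ..
  show ?case
  proof (rule euler_scheme[OF conv_yule_has_real_derivative lip])
    fix m i :: nat assume i: "i < m"
    let ?e = "\<lambda>k. w m i k / m - ?F k (i / m)"
    have "w m (Suc i) k - w m i k - ?\<phi> (i / m) = real (k - 1) * ?e (k - 1) - (real (k - 1) + \<delta>) * ?e k"
      using step[OF i, of k] "1.prems" by (simp add: algebra_simps add_divide_distrib diff_divide_distrib)
    then have "\<bar>w m (Suc i) k - w m i k - ?\<phi> (i / m)\<bar> \<le> \<bar>real (k - 1) * ?e (k - 1)\<bar> + \<bar>(real (k - 1) + \<delta>) * ?e k\<bar>"
      by (simp only: abs_triangle_ineq4)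
    also have "\<dots> \<le> C / m + (real (k - 1) + \<delta>) * \<bar>?e k\<bar>"
      using C[of m i] i \<delta> by (simp add: abs_mult)
    finally show "\<bar>w m (Suc i) k - w m i k - ?\<phi> (i / m)\<bar> \<le> (real (k - 1) + \<delta>) * \<bar>?e k\<bar> + C / m" by simp
  qed (use "1.prems" \<delta> C0 init in \<open>auto simp: conv_0\<close>)
qed

section \<open>Moment bounds uniform in the table size\<close>

lemma power_le_pochhammer: "0 \<le> x \<Longrightarrow> x ^ r \<le> pochhammer (x :: real) r"
proof (induction r)
  case (Suc r)
  have "x * x ^ r \<le> (x + of_nat r) * pochhammer x r" using Suc by (intro mult_mono) auto
  then show ?case by (simp add: pochhammer_rec')
qed simp

text \<open>Weighted by rising factorials, the upward moves turn into a multiple of the same sum, so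
  one step multiplies it by at most \<open>1 + (r + 1) / m\<close> and adds at most
  \<open>fact r\<close>. The bound is proportional to \<open>n\<close> rather than \<open>m\<close>
  because displacement probabilities are divided by \<open>n\<close>.\<close>

lemma yule_scheme_bound:
  fixes w :: "nat \<Rightarrow> nat \<Rightarrow> real"
  assumes nonneg: "\<And>i k. 0 \<le> w i k"
    and init: "\<And>k. 0 < k \<Longrightarrow> w 0 k = 0"
    and step: "\<And>i k. i < m \<Longrightarrow> 0 < k \<Longrightarrow> w (Suc i) k = w i k + of_bool (k = 1) * g i
      + (real (k - 1) * w i (k - 1) - (real (k - 1) + \<delta>) * w i k) / m"
    and g: "\<And>i. i < m \<Longrightarrow> g i \<le> 1"
    and \<delta>: "0 \<le> \<delta>" and k: "0 < k" and n: "n \<le> m"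
  shows "real k ^ r * w n k \<le> real n * (fact r * exp (real r + 1))"
proof -
  define p where "p j = pochhammer (real j) r" for j
  have p0: "0 \<le> p j" for j unfolding p_def by (rule order_trans[OF _ power_le_pochhammer]) simp_all
  \<comment> \<open>The rising factorial of \<open>j\<close> of length \<open>r + 1\<close>, with
    its first or its last factor split off, gives both sides.\<close>
  have pS: "p (Suc j) * real j = (real j + real r) * p j" for j
    using pochhammer_rec[of "real j" r] pochhammer_rec'[of "real j" r] by (simp add: p_def algebra_simps)
  have p1: "p 1 = fact r" by (simp add: p_def pochhammer_fact)
  define S where "S i = (\<Sum>j\<in>{1..k}. p j * w i j)" for i
  have "S n \<le> real n * fact r * exp (real r + 1)"
  proof (rule gronwall_discrete[OF _ _ _ _ n])
    fix i assume i: "i < m"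
    have "S (Suc i) = (\<Sum>j\<in>{1..k}. p j * w i j + p j * (of_bool (j = 1) * g i)
      + (p j * (real (j - 1) * w i (j - 1)) - (real (j - 1) + \<delta>) * (p j * w i j)) / m)"
      unfolding S_def by (intro sum.cong refl, subst step[OF i])
        (auto simp: algebra_simps add_divide_distrib diff_divide_distrib)
    also have "\<dots> = S i + (\<Sum>j\<in>{1..k}. p j * (of_bool (j = 1) * g i)) +
       ((\<Sum>j\<in>{1..k}. p j * (real (j - 1) * w i (j - 1))) - (\<Sum>j\<in>{1..k}. (real (j - 1) + \<delta>) * (p j * w i j))) / m"
      by (simp add: S_def sum.distrib sum_subtractf sum_divide_distrib[symmetric])
    also have "(\<Sum>j\<in>{1..k}. p j * (of_bool (j = 1) * g i)) = (\<Sum>j\<in>{1..k}. if j = 1 then fact r * g i else 0)"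
      by (intro sum.cong) (auto simp: p1[simplified])
    also have "\<dots> = fact r * g i" using k by simp
    also have "\<dots> \<le> fact r" using g[OF i] by (simp add: mult_left_le)
    also have "(\<Sum>j\<in>{1..k}. p j * (real (j - 1) * w i (j - 1))) = (\<Sum>j\<in>{0..k-1}. p (Suc j) * (real j * w i j))"
      using k by (intro sum.reindex_bij_witness[of _ Suc "\<lambda>j. j - 1"]) auto
    also have "\<dots> = (\<Sum>j\<in>{1..k-1}. p (Suc j) * (real j * w i j))"
      by (intro sum.mono_neutral_right) auto
    \<comment> \<open>The flow out of level \<open>k\<close> leaves the truncated sum. Adding it
      back is harmless for an upper bound and gives all sums the same range.\<close>
    also have "\<dots> \<le> (\<Sum>j\<in>{1..k}. p (Suc j) * (real j * w i j))"
      by (intro sum_mono2) (auto intro!: mult_nonneg_nonneg p0 nonneg)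
    also have "\<dots> = (\<Sum>j\<in>{1..k}. (real j + real r) * (p j * w i j))"
      by (intro sum.cong refl) (metis pS mult.assoc)
    also have "(\<Sum>j\<in>{1..k}. (real j + real r) * (p j * w i j)) - (\<Sum>j\<in>{1..k}. (real (j - 1) + \<delta>) * (p j * w i j))
       = (\<Sum>j\<in>{1..k}. (real r + 1 - \<delta>) * (p j * w i j))"
      unfolding sum_subtractf[symmetric] by (intro sum.cong refl) (auto simp: algebra_simps of_nat_diff)
    also have "\<dots> = (real r + 1 - \<delta>) * S i" by (simp add: S_def sum_distrib_left)
    also have "\<dots> \<le> (real r + 1) * S i"
      using \<delta> by (intro mult_right_mono) (auto simp: S_def intro!: sum_nonneg mult_nonneg_nonneg p0 nonneg)
    finally show "S (Suc i) \<le> (1 + (real r + 1) / m) * S i + fact r"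
      using i by (simp add: algebra_simps divide_right_mono)
  qed (auto simp: S_def init)
  moreover have "real k ^ r * w n k \<le> p k * w n k"
    unfolding p_def by (intro mult_right_mono power_le_pochhammer nonneg) simp
  moreover have "p k * w n k \<le> S n"
    unfolding S_def using k by (intro member_le_sum) (auto intro!: mult_nonneg_nonneg p0 nonneg)
  ultimately show ?thesis by (simp add: mult.assoc)
qed

section \<open>Passage to the limit under moment bounds\<close>

lemma tendsto_suminf_of_moments:
  fixes a :: "nat \<Rightarrow> nat \<Rightarrow> real"
  assumes lim: "\<And>k. (\<lambda>N. a N k) \<longlonglongrightarrow> p k"
    and nonneg: "\<And>N k. 0 \<le> a N k" and le1: "\<And>N k. a N k \<le> 1"
    and bound: "\<And>r. \<exists>C. \<forall>N k. 0 < k \<longrightarrow> real k ^ r * a N k \<le> C"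
    and f: "\<And>k. 0 < k \<Longrightarrow> \<bar>f k\<bar> \<le> real k ^ s"
  shows "summable (\<lambda>k. \<bar>f k * a N k\<bar>)" "summable (\<lambda>k. \<bar>f k * p k\<bar>)"
    "(\<lambda>N. \<Sum>k. f k * a N k) \<longlonglongrightarrow> (\<Sum>k. f k * p k)"
proof -
  \<comment> \<open>The two powers beyond \<open>s\<close> leave the summable majorant C / k^2 for
    Tannery's theorem.\<close>
  obtain C where C: "\<And>N k. 0 < k \<Longrightarrow> real k ^ (s + 2) * a N k \<le> C" using bound by blast
  \<comment> \<open>At \<open>k = 0\<close> the inverse is 0 by convention and the moment bound
    gives no information; there \<open>a N 0 \<le> 1\<close> makes \<open>\<bar>f 0\<bar>\<close> a
    majorant.\<close>
  define M where "M k = C * inverse (real k ^ 2) + (if k = 0 then \<bar>f 0\<bar> else 0)" for k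
  have "summable (\<lambda>k. inverse (real k ^ 2))" by (rule inverse_power_summable) simp
  then have M: "summable M" unfolding M_def
    by (intro summable_add[OF summable_mult summable_finite[of "{0}"]]) auto
  have le: "norm (f k * a N k) \<le> M k" for k N
  proof (cases "k = 0")
    case True
    then show ?thesis using le1[of N 0] nonneg[of N 0] by (simp add: M_def abs_mult mult_left_le)
  next
    case False
    have "\<bar>f k\<bar> * a N k \<le> real k ^ s * a N k" using False f nonneg by (intro mult_right_mono) auto
    also have "\<dots> = (real k ^ (s + 2) * a N k) * inverse (real k ^ 2)"
      using False by (simp add: power_add power2_eq_square field_simps)
    also have "\<dots> \<le> C * inverse (real k ^ 2)" using C False by (intro mult_right_mono) auto
    finally show ?thesis using False nonneg[of N k] by (simp add: M_def abs_mult)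
  qed
  have "eventually (\<lambda>(k, N). norm (f k * a N k) \<le> M k) (at_top \<times>\<^sub>F sequentially)"
    using le by (intro always_eventually) auto
  from tannerys_theorem[OF tendsto_mult[OF tendsto_const lim] this M]
  show "summable (\<lambda>k. \<bar>f k * p k\<bar>)" "(\<lambda>N. \<Sum>k. f k * a N k) \<longlonglongrightarrow> (\<Sum>k. f k * p k)" by simp_all
  show "summable (\<lambda>k. \<bar>f k * a N k\<bar>)" using le by (intro summable_comparison_test'[OF M]) auto
qed

lemma expectation_nat_pmf:
  fixes X :: "nat pmf" and f :: "nat \<Rightarrow> real"
  assumes "summable (\<lambda>k. \<bar>f k * pmf X k\<bar>)"
  shows "integrable (measure_pmf X) f" "measure_pmf.expectation X f = (\<Sum>k. f k * pmf X k)"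
proof -
  have "integrable (count_space UNIV) (\<lambda>k. pmf X k *\<^sub>R f k)"
    using assms by (simp add: integrable_count_space_nat_iff mult.commute)
  then show "integrable (measure_pmf X) f" "measure_pmf.expectation X f = (\<Sum>k. f k * pmf X k)"
    by (simp_all add: measure_pmf_eq_density integrable_density integral_density integral_count_space_nat mult.commute)
qed

text \<open>Rounding the exponent up reduces real moments to integer ones, since \<open>k\<close> is
  at least 1.\<close>

lemma real_power_le: "0 < k \<Longrightarrow> 0 \<le> r \<Longrightarrow> \<bar>real_power k r\<bar> \<le> real k ^ nat \<lceil>r\<rceil>"
proof -
  assume k: "0 < k" and r: "0 \<le> r"
  have "real k powr r \<le> real k powr real (nat \<lceil>r\<rceil>)"
    using k r by (intro powr_mono) linarith+
  then show ?thesis using k by (simp add: real_power_def powr_realpow)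
qed

context
  fixes X :: "nat \<Rightarrow> nat pmf" and p :: "nat \<Rightarrow> real"
  assumes lim: "\<And>k. (\<lambda>N. pmf (X N) k) \<longlonglongrightarrow> p k"
    and bound: "\<And>r. \<exists>C. \<forall>N k. 0 < k \<longrightarrow> real k ^ r * pmf (X N) k \<le> C"
begin

lemmas tendsto_suminf_pmf = tendsto_suminf_of_moments[OF lim pmf_nonneg pmf_le_1 bound]

text \<open>Bounded moments keep mass from escaping to infinity, so the total mass 1 passes to the
  limit without evaluating any integral.\<close>

lemma limit_probability_distribution: "probability_distribution p"
proof -
  have s: "summable (\<lambda>k. \<bar>1 * p k\<bar>)" "(\<lambda>N. \<Sum>k. 1 * pmf (X N) k) \<longlonglongrightarrow> (\<Sum>k. 1 * p k)"
    by (rule tendsto_suminf_pmf(2)[of "\<lambda>_. 1" 0], simp, rule tendsto_suminf_pmf(3)[of "\<lambda>_. 1" 0], simp)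
  have "(\<Sum>k. 1 * pmf (X N) k) = 1" for N
    using expectation_nat_pmf(2)[OF tendsto_suminf_pmf(1)[of "\<lambda>_. 1" 0 N]] by simp
  then have "(\<Sum>k. p k) = 1" using s(2) by (simp add: LIMSEQ_const_iff)
  moreover have "summable p" using s(1) by (simp add: summable_rabs_cancel)
  moreover have "0 \<le> p k" for k by (rule LIMSEQ_le_const[OF lim]) simp
  ultimately show ?thesis by (simp add: probability_distribution_def sums_iff)
qed

lemma expectation_tendsto:
  assumes D: "\<And>k. pmf D k = p k" and f: "\<And>k. 0 < k \<Longrightarrow> \<bar>f k\<bar> \<le> real k ^ s"
  shows "integrable (measure_pmf (X N)) f" "integrable (measure_pmf D) f"
    "(\<lambda>N. measure_pmf.expectation (X N) f) \<longlonglongrightarrow> measure_pmf.expectation D f"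
proof -
  note t = tendsto_suminf_pmf[of f s, OF f]
  have d: "summable (\<lambda>k. \<bar>f k * pmf D k\<bar>)" using t(2) by (simp add: D)
  show "integrable (measure_pmf (X N)) f" by (rule expectation_nat_pmf(1)[OF t(1)])
  show "integrable (measure_pmf D) f" by (rule expectation_nat_pmf(1)[OF d])
  show "(\<lambda>N. measure_pmf.expectation (X N) f) \<longlonglongrightarrow> measure_pmf.expectation D f"
    using t(3) by (simp add: expectation_nat_pmf(2)[OF t(1)] expectation_nat_pmf(2)[OF d] D)
qed

lemma limit_all_moments_converge:
  assumes D: "\<And>k. pmf D k = p k"
  shows "all_moments_converge X D"
  unfolding all_moments_converge_def by (intro allI impI conjI expectation_tendsto[OF D real_power_le])

text \<open>The distribution function at \<open>x\<close> is the mean of the indicator of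
  \<open>{..x}\<close>, a bounded test function, so the previous limit applies at every
  \<open>x\<close>.\<close>

lemma limit_converges_in_distribution:
  assumes D: "\<And>k. pmf D k = p k"
  shows "converges_in_distribution X D"
proof -
  have cdf: "cdf (distr (measure_pmf Y) borel real) x = measure_pmf.expectation Y (\<lambda>k. indicator {..x} (real k))"
    for x and Y :: "nat pmf"
    unfolding cdf_def by (subst measure_distr) (auto simp: indicator_vimage[symmetric])
  show ?thesis
    unfolding converges_in_distribution_def weak_conv_m_def weak_conv_def cdf
    by (intro allI impI expectation_tendsto(3)[OF D, where s = 0]) (simp add: indicator_def)
qed

end

section \<open>Limits of the search lengths\<close>

text \<open>As \<open>1 - \<alpha> + t = 1 - (\<alpha> - t)\<close>, the source is
  \<open>1 - x\<close>, the fraction of empty cells at load \<open>x\<close>. In the late law it is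
  integrated once more to x - x^2 / 2; in the early law the source is \<open>x\<close>, the
  probability of hitting an occupied cell.\<close>

lemma p_U_conv: "0 < k \<Longrightarrow> p_U \<alpha> k = conv 1 (-1) 0 (yule 0 k) \<alpha>"
  by (simp add: p_U_def conv_def yule_def diff_add_eq add_diff_eq)

lemma p_L_conv: "0 < k \<Longrightarrow> 0 < \<alpha> \<Longrightarrow> p_L \<alpha> k = 1 / \<alpha> * conv 0 1 (-1/2) (yule 0 k) \<alpha>"
  by (simp add: p_L_def conv_def yule_def)

lemma p_E_conv: "0 < k \<Longrightarrow> 0 < \<alpha> \<Longrightarrow> p_E \<alpha> k = 1 / \<alpha> * conv 0 1 0 (yule 1 k) \<alpha>"
  by (simp add: p_E_def conv_def yule_def mult.assoc)

lemma mean_unsuccessful_scheme: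
  assumes "i < m" "0 < k"
  shows "mean_unsuccessful P m (Suc i) k = mean_unsuccessful P m i k + of_bool (k = 1) * (1 + (-1) * (i / m))
    + (real (k - 1) * mean_unsuccessful P m i (k - 1) - (real (k - 1) + 0) * mean_unsuccessful P m i k) / m"
  using mean_unsuccessful_Suc[OF assms, of P] assms
  by (simp add: add_divide_distrib diff_divide_distrib right_diff_distrib)

lemma mean_displaced_Early_scheme:
  assumes "i < m" "0 < k"
  shows "mean_displaced Early m (Suc i) k = mean_displaced Early m i k + of_bool (k = 1) * (0 + 1 * (i / m))
    + (real (k - 1) * mean_displaced Early m i (k - 1) - (real (k - 1) + 1) * mean_displaced Early m i k) / m"
  using mean_displaced_Early_Suc[OF assms(1), of k] assms
  by (simp add: add_divide_distrib diff_divide_distrib of_nat_diff)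

lemma mean_unsuccessful_bound:
  assumes "0 < k" "n \<le> m"
  shows "real k ^ r * mean_unsuccessful P m n k \<le> real n * (fact r * exp (real r + 1))"
  by (rule yule_scheme_bound[OF mean_unsuccessful_nonneg mean_unsuccessful_init mean_unsuccessful_scheme])
    (use assms in auto)

lemma mean_displaced_bound:
  assumes "0 < k" "n \<le> m"
  shows "real k ^ r * mean_displaced P m n k \<le> real n * (fact r * exp (real r + 1))"
proof (cases P)
  case Early
  show ?thesis unfolding Early
    by (rule yule_scheme_bound[OF mean_displaced_nonneg mean_displaced_init mean_displaced_Early_scheme])
      (use assms in auto)
next
  case Late
  let ?C = "fact r * exp (real r + 1) :: real"
  have "real k ^ r * mean_displaced Late m i k \<le> real i * ?C" if "i \<le> m" for i
    using that
  proof (induction i)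
    case (Suc i)
    \<comment> \<open>One late insertion adds at most \<open>(i / m) * ?C \<le> ?C\<close>, which
      keeps the bound proportional to \<open>i\<close>.\<close>
    have "real k ^ r * (mean_unsuccessful Late m i k / m) \<le> (real i * ?C) / m"
      using mean_unsuccessful_bound[OF assms(1), of i m r] Suc.prems by (simp add: divide_right_mono)
    also have "\<dots> = (real i / m) * ?C" by simp
    also have "\<dots> \<le> 1 * ?C" using Suc.prems by (intro mult_right_mono) (auto simp: divide_simps)
    finally show ?case using Suc mean_displaced_Late_Suc[of i m k] by (simp add: algebra_simps)
  qed (simp add: mean_displaced_init)
  then show ?thesis using assms(2) Late by simp
qed

text \<open>Under both policies an item has displacement 0 exactly when its address was empty at its
  insertion, and later insertions do not change this. So the mean is the sum of
  \<open>1 - i / m\<close> over \<open>i < n\<close>.\<close>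

lemma mean_displaced_0:
  assumes "n \<le> m"
  shows "mean_displaced P m n 0 = real n - real n * (real n - 1) / (2 * real m)"
  using assms
proof (induction n)
  case 0
  then show ?case by (simp add: mean_displaced_init)
next
  case (Suc n)
  have "mean_displaced P m (Suc n) 0 = mean_displaced P m n 0 + (real m - real n) / m"
    using Suc.prems mean_displaced_Early_Suc[of n m 0] mean_displaced_Late_Suc[of n m 0]
    by (cases P) (auto simp: mean_unsuccessful_0)
  also have "\<dots> = real n - real n * (real n - 1) / (2 * real m) + (real m - real n) / m"
    using Suc by simp
  also have "\<dots> = real (Suc n) - real (Suc n) * (real (Suc n) - 1) / (2 * real m)"
    using Suc.prems by (simp add: field_simps)
  finally show ?case .
qed

text \<open>The late counts sum up the unsuccessful ones, so the scheme is a mere numerical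
  integration (\<open>c = 0\<close>) whose slope is known up to order 1 / m. The limit is a
  primitive of \<open>conv 1 (-1) 0\<close> because x - x^2 / 2 is one of 1 - x.\<close>

lemma mean_displaced_Late_euler:
  assumes k: "0 < k"
  shows "\<exists>C. \<forall>m i. 0 < m \<longrightarrow> i \<le> m \<longrightarrow>
    \<bar>mean_displaced Late m i k / m - conv 0 1 (-1/2) (yule 0 k) (i / m)\<bar> \<le> C / m"
proof -
  obtain C where C: "\<And>m i. 0 < m \<Longrightarrow> i \<le> m \<Longrightarrow>
      \<bar>mean_unsuccessful Late m i k / m - conv 1 (-1) 0 (yule 0 k) (i / m)\<bar> \<le> C / m"
    using yule_scheme[of "mean_unsuccessful Late", OF mean_unsuccessful_init mean_unsuccessful_scheme _ k] by auto
  obtain B where B: "B-lipschitz_on {0..1} (conv 1 (-1) 0 (yule 0 k))"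
    using lipschitz_conv[OF continuous_on_yule] by blast
  show ?thesis
  proof (rule euler_scheme[OF _ B])
    show "(conv 0 1 (-1/2) (yule 0 k) has_real_derivative conv 1 (-1) 0 (yule 0 k) x) (at x within {0..1})"
      if "x \<in> {0..1}" for x
      using conv_has_real_derivative[OF continuous_on_yule that, of 0 1 "-1/2" 0 k] by simp
    fix m i :: nat assume i: "i < m"
    have "C / m \<le> \<bar>C\<bar> / m" by (simp add: divide_right_mono)
    then show "\<bar>mean_displaced Late m (Suc i) k - mean_displaced Late m i k - conv 1 (-1) 0 (yule 0 k) (i / m)\<bar>
      \<le> 0 * \<bar>mean_displaced Late m i k / m - conv 0 1 (-1/2) (yule 0 k) (i / m)\<bar> + \<bar>C\<bar> / m"
      using C[of m i] i mean_displaced_Late_Suc[OF i, of k] by simp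
  qed (auto simp: conv_0 mean_displaced_init)
qed

section \<open>Limits along a sequence of tables with converging load factor\<close>

context
  fixes m n :: "nat \<Rightarrow> nat" and \<alpha> :: real
  assumes m: "filterlim m at_top sequentially"
    and n: "\<And>N. 0 < n N \<and> n N \<le> m N"
    and \<alpha>: "(\<lambda>N. real (n N) / real (m N)) \<longlonglongrightarrow> \<alpha>"
begin

lemma m_pos: "0 < m N" and n_pos: "0 < n N" and n_le: "n N \<le> m N"
  using n[of N] by auto

lemma alpha_nonneg: "0 \<le> \<alpha>"
  by (rule LIMSEQ_le_const[OF \<alpha>]) simp

lemma inverse_m_tendsto: "(\<lambda>N. 1 / real (m N)) \<longlonglongrightarrow> 0"
  using filterlim_compose[OF filterlim_real_sequentially m]
  by (intro tendsto_divide_0[OF tendsto_const] filterlim_at_top_imp_at_infinity)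

lemma pmf_random_unsuccessful_tendsto:
  "(\<lambda>N. pmf (random_unsuccessful P (m N) (n N)) k) \<longlonglongrightarrow> p_U \<alpha> k"
proof (cases "k = 0")
  case True
  have "pmf (random_unsuccessful P (m N) (n N)) 0 = 1 - real (n N) / real (m N)" for N
    using m_pos[of N] by (simp add: pmf_random_unsuccessful mean_unsuccessful_0 n_le diff_divide_distrib)
  then show ?thesis using tendsto_diff[OF tendsto_const \<alpha>, of 1] by (simp add: True p_U_def)
next
  case False
  then have k: "0 < k" by simp
  obtain C where "\<And>m i. 0 < m \<Longrightarrow> i \<le> m \<Longrightarrow>
      \<bar>mean_unsuccessful P m i k / m - conv 1 (-1) 0 (yule 0 k) (i / m)\<bar> \<le> C / m"
    using yule_scheme[of "mean_unsuccessful P", OF mean_unsuccessful_init mean_unsuccessful_scheme _ k] by auto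
  from euler_scheme_tendsto[of "\<lambda>m i. mean_unsuccessful P m i k", OF this continuous_on_conv[OF continuous_on_yule] m n_le m_pos \<alpha>]
  show ?thesis using m_pos by (simp add: pmf_random_unsuccessful p_U_conv k)
qed

lemma pmf_random_unsuccessful_bound:
  "\<exists>C. \<forall>N k. 0 < k \<longrightarrow> real k ^ r * pmf (random_unsuccessful P (m N) (n N)) k \<le> C"
proof (intro exI allI impI)
  fix N k :: nat assume k: "0 < k"
  let ?C = "fact r * exp (real r + 1) :: real"
  have "real k ^ r * pmf (random_unsuccessful P (m N) (n N)) k = (real k ^ r * mean_unsuccessful P (m N) (n N) k) / m N"
    using m_pos by (simp add: pmf_random_unsuccessful)
  also have "\<dots> \<le> (real (m N) * ?C) / m N"
    using mean_unsuccessful_bound[OF k n_le[of N], of r P] n_le[of N]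
    by (intro divide_right_mono) (auto intro: order_trans mult_right_mono)
  finally show "real k ^ r * pmf (random_unsuccessful P (m N) (n N)) k \<le> ?C" using m_pos[of N] by simp
qed

lemma pmf_random_displacement_0_tendsto:
  "(\<lambda>N. pmf (random_displacement P (m N) (n N)) 0) \<longlonglongrightarrow> 1 - \<alpha> / 2"
proof -
  have "pmf (random_displacement P (m N) (n N)) 0 = 1 - (real (n N) / real (m N) - 1 / real (m N)) / 2" for N
    using m_pos[of N] n_pos[of N] by (simp add: pmf_random_displacement mean_displaced_0 n_le field_simps)
  then show ?thesis using tendsto_diff[OF tendsto_const tendsto_divide[OF tendsto_diff[OF \<alpha> inverse_m_tendsto] tendsto_const], of 2 1]
    by simp
qed

lemma pmf_random_displacement_tendsto:
  assumes k: "0 < k" and K: "continuous_on {0..1} K"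
    and C: "\<exists>C. \<forall>m i. 0 < m \<longrightarrow> i \<le> m \<longrightarrow> \<bar>mean_displaced P m i k / m - conv 0 1 c K (i / m)\<bar> \<le> C / m"
  shows "(\<lambda>N. pmf (random_displacement P (m N) (n N)) k) \<longlonglongrightarrow> (if \<alpha> = 0 then 0 else 1 / \<alpha> * conv 0 1 c K \<alpha>)"
proof (cases "\<alpha> = 0")
  case True
  \<comment> \<open>For \<open>\<alpha> = 0\<close> the quotient of limits used in the other case is
    0 / 0. Instead, the probability of displacement 0 tends to 1 and leaves no mass for
    \<open>k > 0\<close>.\<close>
  have le: "pmf (random_displacement P (m N) (n N)) k \<le> 1 - pmf (random_displacement P (m N) (n N)) 0" for N
  proof -
    have "(\<Sum>j\<in>{0, k}. pmf (random_displacement P (m N) (n N)) j) \<le> 1"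
      by (subst measure_measure_pmf_finite[symmetric]) auto
    then show ?thesis using k by simp
  qed
  have lim: "(\<lambda>N. 1 - pmf (random_displacement P (m N) (n N)) 0) \<longlonglongrightarrow> 0"
    using tendsto_diff[OF tendsto_const pmf_random_displacement_0_tendsto, of 1 P] True by simp
  have "(\<lambda>N. pmf (random_displacement P (m N) (n N)) k) \<longlonglongrightarrow> 0"
    by (rule tendsto_sandwich[OF _ _ tendsto_const lim]) (simp_all add: le)
  then show ?thesis using True by simp
next
  case False
  obtain C where "\<And>m i. 0 < m \<Longrightarrow> i \<le> m \<Longrightarrow> \<bar>mean_displaced P m i k / m - conv 0 1 c K (i / m)\<bar> \<le> C / m"
    using C by blast
  from euler_scheme_tendsto[of "\<lambda>m i. mean_displaced P m i k", OF this continuous_on_conv[OF K] m n_le m_pos \<alpha>]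
  have "(\<lambda>N. (mean_displaced P (m N) (n N) k / m N) / (n N / m N)) \<longlonglongrightarrow> conv 0 1 c K \<alpha> / \<alpha>"
    using \<alpha> False by (intro tendsto_divide) auto
  moreover have "(mean_displaced P (m N) (n N) k / m N) / (n N / m N) = pmf (random_displacement P (m N) (n N)) k" for N
    using m_pos[of N] n_pos[of N] by (simp add: pmf_random_displacement)
  ultimately show ?thesis using False by simp
qed

lemma pmf_random_displacement_Late_tendsto:
  "(\<lambda>N. pmf (random_displacement Late (m N) (n N)) k) \<longlonglongrightarrow> p_L \<alpha> k"
proof (cases "k = 0")
  case True
  then show ?thesis using pmf_random_displacement_0_tendsto by (simp add: p_L_def)
next
  case False
  then have k: "0 < k" by simp
  show ?thesis using pmf_random_displacement_tendsto[OF k continuous_on_yule mean_displaced_Late_euler[OF k]]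
      p_L_conv[OF k, of \<alpha>] alpha_nonneg k
    by (cases "\<alpha> = 0") (auto simp: p_L_def)
qed

lemma pmf_random_displacement_Early_tendsto:
  "(\<lambda>N. pmf (random_displacement Early (m N) (n N)) k) \<longlonglongrightarrow> p_E \<alpha> k"
proof (cases "k = 0")
  case True
  then show ?thesis using pmf_random_displacement_0_tendsto by (simp add: p_E_def)
next
  case False
  then have k: "0 < k" by simp
  show ?thesis using pmf_random_displacement_tendsto[OF k continuous_on_yule
        yule_scheme[of "mean_displaced Early", OF mean_displaced_init mean_displaced_Early_scheme _ k]]
      p_E_conv[OF k, of \<alpha>] alpha_nonneg k
    by (cases "\<alpha> = 0") (auto simp: p_E_def)
qed

lemma pmf_random_displacement_bound:
  "\<exists>C. \<forall>N k. 0 < k \<longrightarrow> real k ^ r * pmf (random_displacement P (m N) (n N)) k \<le> C"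
proof (intro exI allI impI)
  fix N k :: nat assume k: "0 < k"
  let ?C = "fact r * exp (real r + 1) :: real"
  have "real k ^ r * pmf (random_displacement P (m N) (n N)) k = (real k ^ r * mean_displaced P (m N) (n N) k) / n N"
    using m_pos n_pos by (simp add: pmf_random_displacement)
  also have "\<dots> \<le> (real (n N) * ?C) / n N"
    by (intro divide_right_mono mean_displaced_bound[OF k n_le]) simp
  finally show "real k ^ r * pmf (random_displacement P (m N) (n N)) k \<le> ?C" using n_pos[of N] by simp
qed

lemmas limit_U = pmf_random_unsuccessful_tendsto pmf_random_unsuccessful_bound
lemmas limit_L = pmf_random_displacement_Late_tendsto pmf_random_displacement_bound
lemmas limit_E = pmf_random_displacement_Early_tendsto pmf_random_displacement_bound

lemma probability_distributions:
  "probability_distribution (p_U \<alpha>)" "probability_distribution (p_L \<alpha>)" "probability_distribution (p_E \<alpha>)"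
  by (rule limit_probability_distribution[OF limit_U] limit_probability_distribution[OF limit_L]
    limit_probability_distribution[OF limit_E])+

end

section \<open>Sequences with prescribed limiting load, and the limit theorem\<close>

text \<open>That the limit laws have total mass 1 is derived as a limit statement, so every
  \<open>\<alpha>\<close> in the unit interval needs a sequence of tables with this limiting load.
  The added 1 keeps the number of items positive, also for \<open>\<alpha> = 0\<close>.\<close>

lemma load_factor_sequence:
  fixes \<alpha> :: real
  assumes "0 \<le> \<alpha>" "\<alpha> \<le> 1"
  shows "nat \<lfloor>\<alpha> * N\<rfloor> + 1 \<le> Suc N"
    and "(\<lambda>N. real (nat \<lfloor>\<alpha> * real N\<rfloor> + 1) / real (Suc N)) \<longlonglongrightarrow> \<alpha>"
proof -
  have fl: "\<alpha> * real N - 1 \<le> real (nat \<lfloor>\<alpha> * real N\<rfloor>)" "real (nat \<lfloor>\<alpha> * real N\<rfloor>) \<le> \<alpha> * real N" for N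
  proof -
    have "real (nat \<lfloor>\<alpha> * real N\<rfloor>) = real_of_int \<lfloor>\<alpha> * real N\<rfloor>" using assms by simp
    then show "\<alpha> * real N - 1 \<le> real (nat \<lfloor>\<alpha> * real N\<rfloor>)" "real (nat \<lfloor>\<alpha> * real N\<rfloor>) \<le> \<alpha> * real N"
      using floor_correct[of "\<alpha> * real N"] by linarith+
  qed
  have "\<alpha> * real N \<le> real N" using assms by (simp add: mult_left_le_one_le)
  then show "nat \<lfloor>\<alpha> * N\<rfloor> + 1 \<le> Suc N" using fl[of N] by linarith
  show "(\<lambda>N. real (nat \<lfloor>\<alpha> * real N\<rfloor> + 1) / real (Suc N)) \<longlonglongrightarrow> \<alpha>"
  proof (rule LIM_zero_cancel, rule Lim_null_comparison)
    show "\<forall>\<^sub>F N in sequentially. norm (real (nat \<lfloor>\<alpha> * real N\<rfloor> + 1) / real (Suc N) - \<alpha>) \<le> 1 / real (Suc N)"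
    proof (intro always_eventually allI)
      fix N
      have "real (nat \<lfloor>\<alpha> * real N\<rfloor> + 1) / real (Suc N) - \<alpha> = (real (nat \<lfloor>\<alpha> * real N\<rfloor>) + 1 - \<alpha> * real N - \<alpha>) / real (Suc N)"
        by (simp add: field_simps)
      moreover have "\<bar>real (nat \<lfloor>\<alpha> * real N\<rfloor>) + 1 - \<alpha> * real N - \<alpha>\<bar> \<le> 1" using fl[of N] assms by linarith
      ultimately show "norm (real (nat \<lfloor>\<alpha> * real N\<rfloor> + 1) / real (Suc N) - \<alpha>) \<le> 1 / real (Suc N)"
        by (simp add: abs_divide divide_right_mono)
    qed
    show "(\<lambda>N. 1 / real (Suc N)) \<longlonglongrightarrow> 0" using LIMSEQ_inverse_real_of_nat by (simp add: inverse_eq_divide)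
  qed
qed

theorem theorem2p1:
  fixes \<alpha> :: real
  assumes "0 \<le> \<alpha>" and "\<alpha> \<le> 1"
  shows
    "probability_distribution (p_U \<alpha>) \<and>
     probability_distribution (p_L \<alpha>) \<and>
     probability_distribution (p_E \<alpha>) \<and>
     (\<forall>m n :: nat \<Rightarrow> nat.
        filterlim m at_top sequentially \<longrightarrow>
        filterlim n at_top sequentially \<longrightarrow>
        (\<forall>N. 0 < n N \<and> n N \<le> m N) \<longrightarrow>
        (\<lambda>N. real (n N) / real (m N)) \<longlonglongrightarrow> \<alpha> \<longrightarrow>
        (\<forall>P k.
           (\<forall>N. pmf (random_unsuccessful P (m N) (n N)) k =
              1 / real (m N) * measure_pmf.expectation (random_hashes (m N) (n N))
                 (\<lambda>hs. real (num_unsuccessful P (m N) hs k))) \<and>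
           (\<lambda>N. pmf (random_unsuccessful P (m N) (n N)) k) \<longlonglongrightarrow> p_U \<alpha> k) \<and>
        (\<forall>k.
           (\<forall>N. pmf (random_displacement Late (m N) (n N)) k =
              1 / real (n N) * measure_pmf.expectation (random_hashes (m N) (n N))
                 (\<lambda>hs. real (num_displaced Late (m N) hs k))) \<and>
           (\<lambda>N. pmf (random_displacement Late (m N) (n N)) k) \<longlonglongrightarrow> p_L \<alpha> k) \<and>
        (\<forall>k.
           (\<forall>N. pmf (random_displacement Early (m N) (n N)) k =
              1 / real (n N) * measure_pmf.expectation (random_hashes (m N) (n N))
                 (\<lambda>hs. real (num_displaced Early (m N) hs k))) \<and>
           (\<lambda>N. pmf (random_displacement Early (m N) (n N)) k) \<longlonglongrightarrow> p_E \<alpha> k) \<and>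
        (\<forall>P (D :: nat pmf). (\<forall>k. pmf D k = p_U \<alpha> k) \<longrightarrow>
           converges_in_distribution (\<lambda>N. random_unsuccessful P (m N) (n N)) D \<and>
           all_moments_converge (\<lambda>N. random_unsuccessful P (m N) (n N)) D) \<and>
        (\<forall>D :: nat pmf. (\<forall>k. pmf D k = p_L \<alpha> k) \<longrightarrow>
           converges_in_distribution (\<lambda>N. random_displacement Late (m N) (n N)) D \<and>
           all_moments_converge (\<lambda>N. random_displacement Late (m N) (n N)) D) \<and>
        (\<forall>D :: nat pmf. (\<forall>k. pmf D k = p_E \<alpha> k) \<longrightarrow>
           converges_in_distribution (\<lambda>N. random_displacement Early (m N) (n N)) D \<and>
           all_moments_converge (\<lambda>N. random_displacement Early (m N) (n N)) D))"
proof (intro conjI allI impI)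
  let ?m = Suc and ?n = "\<lambda>N. nat \<lfloor>\<alpha> * real N\<rfloor> + 1"
  have "filterlim ?m at_top sequentially" by (rule filterlim_Suc)
  moreover have "0 < ?n N \<and> ?n N \<le> ?m N" for N using load_factor_sequence(1)[OF assms] by simp
  ultimately show "probability_distribution (p_U \<alpha>)" "probability_distribution (p_L \<alpha>)"
      "probability_distribution (p_E \<alpha>)"
    using probability_distributions[of ?m ?n] load_factor_sequence(2)[OF assms] by blast+
next
  fix m n :: "nat \<Rightarrow> nat"
  assume m: "filterlim m at_top sequentially"
    and n: "\<forall>N. 0 < n N \<and> n N \<le> m N"
    and \<alpha>: "(\<lambda>N. real (n N) / real (m N)) \<longlonglongrightarrow> \<alpha>"
  note n = n[rule_format] and pos = m_pos[OF m n[rule_format] \<alpha>] n_pos[OF m n[rule_format] \<alpha>]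
  note U = limit_U[OF m n \<alpha>] and L = limit_L[OF m n \<alpha>] and E = limit_E[OF m n \<alpha>]
  fix k
  show "pmf (random_unsuccessful P (m N) (n N)) k =
      1 / real (m N) * measure_pmf.expectation (random_hashes (m N) (n N))
        (\<lambda>hs. real (num_unsuccessful P (m N) hs k))" for P N
    using pmf_random_unsuccessful[OF pos(1)] by (simp add: mean_unsuccessful_def)
  show "pmf (random_displacement Late (m N) (n N)) k =
      1 / real (n N) * measure_pmf.expectation (random_hashes (m N) (n N))
        (\<lambda>hs. real (num_displaced Late (m N) hs k))"
    "pmf (random_displacement Early (m N) (n N)) k =
      1 / real (n N) * measure_pmf.expectation (random_hashes (m N) (n N))
        (\<lambda>hs. real (num_displaced Early (m N) hs k))" for N
    using pmf_random_displacement[OF pos] by (simp_all add: mean_displaced_def)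
  show "(\<lambda>N. pmf (random_unsuccessful P (m N) (n N)) k) \<longlonglongrightarrow> p_U \<alpha> k" for P by (rule U(1))
  show "(\<lambda>N. pmf (random_displacement Late (m N) (n N)) k) \<longlonglongrightarrow> p_L \<alpha> k" by (rule L(1))
  show "(\<lambda>N. pmf (random_displacement Early (m N) (n N)) k) \<longlonglongrightarrow> p_E \<alpha> k" by (rule E(1))
  fix D :: "nat pmf"
  show "converges_in_distribution (\<lambda>N. random_unsuccessful P (m N) (n N)) D"
    "all_moments_converge (\<lambda>N. random_unsuccessful P (m N) (n N)) D" if "\<forall>k. pmf D k = p_U \<alpha> k" for P
    using limit_converges_in_distribution[OF U] limit_all_moments_converge[OF U] that by blast+
  show "converges_in_distribution (\<lambda>N. random_displacement Late (m N) (n N)) D"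
    "all_moments_converge (\<lambda>N. random_displacement Late (m N) (n N)) D" if "\<forall>k. pmf D k = p_L \<alpha> k"
    using limit_converges_in_distribution[OF L] limit_all_moments_converge[OF L] that by blast+
  show "converges_in_distribution (\<lambda>N. random_displacement Early (m N) (n N)) D"
    "all_moments_converge (\<lambda>N. random_displacement Early (m N) (n N)) D" if "\<forall>k. pmf D k = p_E \<alpha> k"
    using limit_converges_in_distribution[OF E] limit_all_moments_converge[OF E] that by blast+
qed

end
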